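(* Let $k\ge1$ be an integer and $\epsilon>0$. Let $\delta>0$ satisfy $\delta^k+\delta(4k-1)<\epsilon$ and $(1-\delta)^{-1}<1+\epsilon/2$, and define $S=\{s_1,\ldots,s_{2k}\}$ by $s_{k+i}=\frac{1-\delta^i}{1-\delta}$ and $s_{k-i+1}=-\frac{1-\delta^i}{1-\delta}$ for $i=1,\ldots,k$. Then for $\mathrm{OFAL}(S,c)$ (any capacity $c$), the algorithm PTCP $\mathcal{A}^*$ is $(3+\epsilon)$-competitive, while the competitive ratio of the permutation algorithm $\mathcal{P}$ is at least $4k-1-\epsilon$.
   Context: Online facility assignment on a line $\mathrm{OFAL}(S,c)$: servers $S$ at distinct points of $\mathbb{R}$ (identified with their positions), capacity $c:S\to\mathbb{N}$ with $c(s)\ge1$. A request sequence $\sigma=r_1\cdots r_n$ of points of $\mathbb{R}$, $n\le\sum_s c(s)$, is revealed one at a time; a server is free if fewer than $c(s)$ requests are matched with it; each $r_i$ must be irrevocably matched upon arrival with a free server $s$ at cost $|r_i-s|$. $\mathcal{A}(\sigma|S)$ is the total cost of $\mathcal{A}$, $\mathrm{Opt}(\sigma|S)$ the optimal offline (capacity-respecting) cost. $\mathcal{A}$ is $\beta$-competitive if $\mathcal{A}(\sigma|S)\le\beta\,\mathrm{Opt}(\sigma|S)$ for all $\sigma$; the competitive ratio is the infimum of such $\beta\ge1$. Permutation algorithm $\mathcal{P}$: for $\sigma=r_1\cdots r_n$, let $M_i$ be an optimal (minimum-cost, capacity-respecting) matching of $r_1,\ldots,r_i$, and $S_i$ the collection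 of servers used by $M_i$ ($S_0=\emptyset$); the optimal matchings can be chosen so that $S_i\setminus S_{i-1}$ consists of a single server $s$ for each $i$. When $r_i$ arrives, $\mathcal{P}$ matches $r_i$ with this server $s$. PTCP: for a server set $S=\{s_1<\cdots<s_m\}$ and nonempty set $F\subseteq S$ of free servers, $\mathcal{A}^*[S](r,F)$ is defined recursively: if $F=\{s\}$ output $s$; otherwise fix $a$ with $s_{a+1}-s_a=\max_u(s_{u+1}-s_u)$, let $S_1=\{s_1,\ldots,s_a\}$, $S_2=\{s_{a+1},\ldots,s_m\}$, $\Delta_1=s_a-s_1$, $\Delta_2=s_m-s_{a+1}$, $D=s_{a+1}-s_a$, $x=\frac{\Delta_2+D}{\Delta_1+\Delta_2+2D}D$; if ($r\le s_a+x$ and $F\cap S_1\ne\emptyset$) or $F\cap S_2=\emptyset$ output $\mathcal{A}^*[S_1](r,F\cap S_1)$, otherwise output $\mathcal{A}^*[S_2](r,F\cap S_2)$. $\mathcal{A}^*$ matches each arriving request $r$ with $\mathcal{A}^*[S](r,F)$ for the current free set $F$. *)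

theory Defs
  imports "HOL-Library.Multiset" "HOL-Library.Extended_Real"
begin

section \<open>Online facility assignment on a line\<close>

text \<open>
  Servers are identified with their positions, so an instance is a finite set \<open>S\<close> of reals with
  capacities \<open>c\<close>. A matching of a request sequence \<open>\<sigma>\<close> is a list of servers of the same length;
  its \<open>i\<close>-th entry is the server assigned to the \<open>i\<close>-th request.
\<close>

definition ofal_instance :: "real set \<Rightarrow> (real \<Rightarrow> nat) \<Rightarrow> bool" where
  "ofal_instance S c \<longleftrightarrow> finite S \<and> S \<noteq> {} \<and> (\<forall>s\<in>S. 1 \<le> c s)"

definition feasible_matching ::
    "real set \<Rightarrow> (real \<Rightarrow> nat) \<Rightarrow> real list \<Rightarrow> real list \<Rightarrow> bool" where
  "feasible_matching S c \<sigma> ms \<longleftrightarrow>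
     length ms = length \<sigma> \<and> set ms \<subseteq> S \<and> (\<forall>s\<in>S. count_list ms s \<le> c s)"

definition matching_cost :: "real list \<Rightarrow> real list \<Rightarrow> real" where
  "matching_cost \<sigma> ms = (\<Sum>i<length \<sigma>. \<bar>\<sigma> ! i - ms ! i\<bar>)"

definition optimal_matching ::
    "real set \<Rightarrow> (real \<Rightarrow> nat) \<Rightarrow> real list \<Rightarrow> real list \<Rightarrow> bool" where
  "optimal_matching S c \<sigma> ms \<longleftrightarrow> is_arg_min (matching_cost \<sigma>) (feasible_matching S c \<sigma>) ms"

definition opt_cost :: "real set \<Rightarrow> (real \<Rightarrow> nat) \<Rightarrow> real list \<Rightarrow> real" where
  "opt_cost S c \<sigma> = Min (matching_cost \<sigma> ` {ms. feasible_matching S c \<sigma> ms})"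

definition free_servers :: "real set \<Rightarrow> (real \<Rightarrow> nat) \<Rightarrow> real list \<Rightarrow> real set" where
  "free_servers S c ms = {s \<in> S. count_list ms s < c s}"

text \<open>
  An algorithm is represented by the function that sends a request sequence to the matching it
  produces. It is online if serving one more request keeps the earlier decisions and matches the
  new request with a free server. Nothing is required of sequences exceeding the total capacity.
\<close>

definition online_algorithm ::
    "real set \<Rightarrow> (real \<Rightarrow> nat) \<Rightarrow> (real list \<Rightarrow> real list) \<Rightarrow> bool" where
  "online_algorithm S c A \<longleftrightarrow> A [] = [] \<and>
     (\<forall>\<sigma> r. length \<sigma> < sum c S \<longrightarrow> (\<exists>s\<in>free_servers S c (A \<sigma>). A (\<sigma> @ [r]) = A \<sigma> @ [s]))"

definition competitive ::
    "real set \<Rightarrow> (real \<Rightarrow> nat) \<Rightarrow> (real list \<Rightarrow> real list) \<Rightarrow> real \<Rightarrow> bool" where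
  "competitive S c A \<beta> \<longleftrightarrow>
     (\<forall>\<sigma>. length \<sigma> \<le> sum c S \<longrightarrow> matching_cost \<sigma> (A \<sigma>) \<le> \<beta> * opt_cost S c \<sigma>)"

text \<open>The infimum is taken in the extended reals, so it is \<open>\<infinity>\<close> if no \<open>\<beta>\<close> works.\<close>

definition competitive_ratio ::
    "real set \<Rightarrow> (real \<Rightarrow> nat) \<Rightarrow> (real list \<Rightarrow> real list) \<Rightarrow> ereal" where
  "competitive_ratio S c A = Inf (ereal ` {\<beta>. 1 \<le> \<beta> \<and> competitive S c A \<beta>})"

section \<open>The permutation algorithm\<close>

text \<open>
  \<open>M\<close> selects an optimal matching for every prefix of the input. The servers used by a matching
  form a multiset, a server of capacity \<open>> 1\<close> being possibly used more than once. Different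
  selections \<open>M\<close> may give different algorithms; the predicate holds for all of them.
\<close>

definition permutation_algorithm ::
    "real set \<Rightarrow> (real \<Rightarrow> nat) \<Rightarrow> (real list \<Rightarrow> real list) \<Rightarrow> bool" where
  "permutation_algorithm S c P \<longleftrightarrow>
     (\<exists>M. (\<forall>\<sigma>. length \<sigma> \<le> sum c S \<longrightarrow> optimal_matching S c \<sigma> (M \<sigma>)) \<and>
          P [] = [] \<and>
          (\<forall>\<sigma> r. length \<sigma> < sum c S \<longrightarrow>
             (\<exists>s. mset (M (\<sigma> @ [r])) = add_mset s (mset (M \<sigma>)) \<and> P (\<sigma> @ [r]) = P \<sigma> @ [s])))"

section \<open>The algorithm PTCP\<close>

definition next_server :: "real set \<Rightarrow> real \<Rightarrow> real" where
  "next_server S u = Min {t \<in> S. u < t}"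

definition widest_gap_at :: "real set \<Rightarrow> real \<Rightarrow> bool" where
  "widest_gap_at S u \<longleftrightarrow> u \<in> S \<and> u < Max S \<and>
     (\<forall>v\<in>S. v < Max S \<longrightarrow> next_server S v - v \<le> next_server S u - u)"

text \<open>
  A widest gap need not be unique. Which one is used for a set of servers is fixed in advance by a
  function \<open>p\<close> returning the left end point \<open>s\<^sub>a\<close> of the gap chosen.
\<close>

definition gap_choice :: "(real set \<Rightarrow> real) \<Rightarrow> bool" where
  "gap_choice p \<longleftrightarrow> (\<forall>T. finite T \<and> 2 \<le> card T \<longrightarrow> widest_gap_at T (p T))"

partial_function (tailrec) ptcp ::
    "(real set \<Rightarrow> real) \<Rightarrow> real set \<Rightarrow> real \<Rightarrow> real set \<Rightarrow> real" where
  "ptcp p S r F =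
     (if is_singleton F then the_elem F
      else
        let sa = p S;
            S\<^sub>1 = {s \<in> S. s \<le> sa};
            S\<^sub>2 = {s \<in> S. sa < s};
            \<Delta>\<^sub>1 = sa - Min S;
            \<Delta>\<^sub>2 = Max S - next_server S sa;
            D = next_server S sa - sa;
            x = (\<Delta>\<^sub>2 + D) / (\<Delta>\<^sub>1 + \<Delta>\<^sub>2 + 2 * D) * D
        in if (r \<le> sa + x \<and> F \<inter> S\<^sub>1 \<noteq> {}) \<or> F \<inter> S\<^sub>2 = {}
           then ptcp p S\<^sub>1 r (F \<inter> S\<^sub>1)
           else ptcp p S\<^sub>2 r (F \<inter> S\<^sub>2))"

definition ptcp_algorithm ::
    "(real set \<Rightarrow> real) \<Rightarrow> real set \<Rightarrow> (real \<Rightarrow> nat) \<Rightarrow> real list \<Rightarrow> real list" where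
  "ptcp_algorithm p S c \<sigma> = foldl (\<lambda>ms r. ms @ [ptcp p S r (free_servers S c ms)]) [] \<sigma>"

section \<open>Existence and soundness\<close>

text \<open>
  Permutation algorithms and gap choices exist, and both permutation algorithms and PTCP are online
  algorithms.
\<close>

lemma gap_choice_exists: "\<exists>p. gap_choice p"
proof -
  have "\<exists>u. widest_gap_at T u" if T: "finite T" "2 \<le> card T" for T
  proof -
    define L where "L = T - {Max T}"
    have "T \<noteq> {}" using T by auto
    have "card L \<ge> 1" using T \<open>T \<noteq> {}\<close> by (simp add: L_def card_Diff_singleton)
    then have L: "L \<noteq> {}" "finite L" using T by (auto simp only: L_def card.empty finite_Diff)
    define G where "G = (\<lambda>v. next_server T v - v) ` L"
    have "Max G \<in> G" using L by (simp add: G_def)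
    then obtain u where u: "u \<in> L" "next_server T u - u = Max G" by (force simp: G_def)
    have "u \<in> T" "u \<noteq> Max T" using u(1) by (simp_all add: L_def)
    then have "u < Max T" using Max_ge[OF T(1)] by (simp add: less_le)
    moreover have "next_server T v - v \<le> next_server T u - u" if "v \<in> T" "v < Max T" for v
      using that L u by (auto simp: G_def L_def intro!: Max_ge)
    ultimately show ?thesis using u by (auto simp: widest_gap_at_def L_def)
  qed
  then have "gap_choice (\<lambda>T. SOME u. widest_gap_at T u)"
    unfolding gap_choice_def by (metis someI_ex)
  then show ?thesis by blast
qed

lemma ptcp_in_free:
  assumes p: "gap_choice p"
  shows "finite S \<Longrightarrow> F \<subseteq> S \<Longrightarrow> F \<noteq> {} \<Longrightarrow> ptcp p S r F \<in> F"
proof (induction "card S" arbitrary: S F rule: less_induct)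
  case less
  show ?case
  proof (cases "is_singleton F")
    case True
    then show ?thesis by (subst ptcp.simps) (auto simp: is_singleton_def)
  next
    case False
    define S1 where "S1 = {s \<in> S. s \<le> p S}"
    define S2 where "S2 = {s \<in> S. p S < s}"
    have "card F \<noteq> 1" "finite F" using False less.prems
      by (auto simp: is_singleton_altdef intro: finite_subset)
    then have "2 \<le> card F" using less.prems(3) card_gt_0_iff[of F] by linarith
    then have "2 \<le> card S" using card_mono[OF less.prems(1,2)] by linarith
    then have w: "widest_gap_at S (p S)" using p less.prems by (auto simp: gap_choice_def)
    have "S \<noteq> {}" using less.prems by auto
    have "Max S \<in> S" using less.prems(1) \<open>S \<noteq> {}\<close> by (rule Max_in)
    moreover have "Max S \<notin> S1" using w unfolding widest_gap_at_def S1_def by simp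
    ultimately have "Max S \<in> S" "Max S \<notin> S1" .
    then have 1: "S1 \<subset> S" by (auto simp: S1_def)
    have 2: "S2 \<subset> S" using w by (auto simp: widest_gap_at_def S2_def)
    have F: "F \<inter> S1 \<union> F \<inter> S2 = F" using less.prems by (auto simp: S1_def S2_def)
    have "card S1 < card S" "card S2 < card S"
      using 1 2 less.prems(1) by (auto intro: psubset_card_mono)
    then have "F \<inter> S1 \<noteq> {} \<Longrightarrow> ptcp p S1 r (F \<inter> S1) \<in> F \<inter> S1"
      and "F \<inter> S2 \<noteq> {} \<Longrightarrow> ptcp p S2 r (F \<inter> S2) \<in> F \<inter> S2"
      using less.hyps[of S1 "F \<inter> S1"] less.hyps[of S2 "F \<inter> S2"] finite_subset[OF _ less.prems(1)]
        psubset_imp_subset[OF 1] psubset_imp_subset[OF 2] by blast+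
    moreover have "\<exists>x. ptcp p S r F = (if r \<le> x \<and> F \<inter> S1 \<noteq> {} \<or> F \<inter> S2 = {}
        then ptcp p S1 r (F \<inter> S1) else ptcp p S2 r (F \<inter> S2))"
      unfolding ptcp.simps[of p S r F] Let_def S1_def S2_def using False by auto
    moreover have "F \<inter> S1 \<noteq> {} \<or> F \<inter> S2 \<noteq> {}" using F less.prems(3) by auto
    ultimately show ?thesis by (smt (verit) IntD1)
  qed
qed

lemma length_eq_sum_count_list:
  "finite S \<Longrightarrow> set xs \<subseteq> S \<Longrightarrow> length xs = (\<Sum>s\<in>S. count_list xs s)"
  by (metis sum_count_set)

lemma free_servers_nonempty:
  assumes "finite S" "feasible_matching S c \<sigma> ms" "length \<sigma> < sum c S"
  shows "free_servers S c ms \<noteq> {}"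
proof
  assume "free_servers S c ms = {}"
  then have "sum c S \<le> (\<Sum>s\<in>S. count_list ms s)"
    by (intro sum_mono) (auto simp: free_servers_def not_less)
  then show False
    using assms length_eq_sum_count_list[of S ms] by (auto simp: feasible_matching_def)
qed

lemma feasible_matching_snoc:
  assumes "feasible_matching S c \<sigma> ms" "s \<in> free_servers S c ms"
  shows "feasible_matching S c (\<sigma> @ [r]) (ms @ [s])"
  using assms by (auto simp: feasible_matching_def free_servers_def)

lemma online_algorithm_feasible:
  assumes "online_algorithm S c A" "length \<sigma> \<le> sum c S"
  shows "feasible_matching S c \<sigma> (A \<sigma>)"
  using assms(2)
proof (induction \<sigma> rule: rev_induct)
  case Nil
  then show ?case using assms(1) by (simp add: online_algorithm_def feasible_matching_def)
next
  case (snoc r \<sigma>)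
  then obtain s where "s \<in> free_servers S c (A \<sigma>)" "A (\<sigma> @ [r]) = A \<sigma> @ [s]"
    using assms(1) unfolding online_algorithm_def by (metis length_append_singleton Suc_le_lessD)
  then show ?case using snoc by (simp add: feasible_matching_snoc)
qed

lemma ptcp_algorithm_online:
  assumes "ofal_instance S c" "gap_choice p"
  shows "online_algorithm S c (ptcp_algorithm p S c)"
proof -
  have S: "finite S" using assms by (simp add: ofal_instance_def)
  have step: "ptcp_algorithm p S c (\<sigma> @ [r]) =
      ptcp_algorithm p S c \<sigma> @ [ptcp p S r (free_servers S c (ptcp_algorithm p S c \<sigma>))]" for \<sigma> r
    by (simp add: ptcp_algorithm_def)
  have free: "ptcp p S r (free_servers S c ms) \<in> free_servers S c ms"
    if "feasible_matching S c \<sigma> ms" "length \<sigma> < sum c S" for r ms \<sigma>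
    using ptcp_in_free[OF assms(2) S, of "free_servers S c ms"] free_servers_nonempty[OF S that]
    by (auto simp: free_servers_def)
  have feas: "length \<sigma> \<le> sum c S \<Longrightarrow> feasible_matching S c \<sigma> (ptcp_algorithm p S c \<sigma>)" for \<sigma>
  proof (induction \<sigma> rule: rev_induct)
    case Nil
    then show ?case by (simp add: ptcp_algorithm_def feasible_matching_def)
  next
    case (snoc r \<sigma>)
    then show ?case unfolding step using free by (intro feasible_matching_snoc) auto
  qed
  show ?thesis
    unfolding online_algorithm_def
  proof (intro conjI allI impI)
    show "ptcp_algorithm p S c [] = []" by (simp add: ptcp_algorithm_def)
    fix \<sigma> :: "real list" and r assume "length \<sigma> < sum c S"
    then show "\<exists>s\<in>free_servers S c (ptcp_algorithm p S c \<sigma>).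
        ptcp_algorithm p S c (\<sigma> @ [r]) = ptcp_algorithm p S c \<sigma> @ [s]"
      using free[OF feas, of \<sigma> r] step[of \<sigma> r] by auto
  qed
qed

lemma permutation_algorithm_online:
  assumes "ofal_instance S c" "permutation_algorithm S c P"
  shows "online_algorithm S c P"
proof -
  obtain M where M: "\<And>\<sigma>. length \<sigma> \<le> sum c S \<Longrightarrow> optimal_matching S c \<sigma> (M \<sigma>)"
    and P0: "P [] = []"
    and step: "\<And>\<sigma> r. length \<sigma> < sum c S \<Longrightarrow>
      \<exists>s. mset (M (\<sigma> @ [r])) = add_mset s (mset (M \<sigma>)) \<and> P (\<sigma> @ [r]) = P \<sigma> @ [s]"
    using assms(2) unfolding permutation_algorithm_def by blast
  have feas: "length \<sigma> \<le> sum c S \<Longrightarrow> feasible_matching S c \<sigma> (M \<sigma>)" for \<sigma>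
    using M by (auto simp: optimal_matching_def is_arg_min_def)
  have eq: "length \<sigma> \<le> sum c S \<Longrightarrow> mset (P \<sigma>) = mset (M \<sigma>)" for \<sigma>
  proof (induction \<sigma> rule: rev_induct)
    case Nil
    then show ?case using feas[of "[]"] P0 by (simp add: feasible_matching_def)
  next
    case (snoc r \<sigma>)
    then show ?case using step[of \<sigma> r] by auto
  qed
  have "\<exists>s\<in>free_servers S c (P \<sigma>). P (\<sigma> @ [r]) = P \<sigma> @ [s]" if l: "length \<sigma> < sum c S" for \<sigma> r
  proof -
    obtain s where s: "mset (M (\<sigma> @ [r])) = add_mset s (mset (M \<sigma>))" "P (\<sigma> @ [r]) = P \<sigma> @ [s]"
      using step[OF l] by blast
    have f: "feasible_matching S c (\<sigma> @ [r]) (M (\<sigma> @ [r]))" using feas l by simp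
    have "s \<in> set (M (\<sigma> @ [r]))" using s(1) by (metis union_single_eq_member set_mset_mset)
    then have "s \<in> S" using f by (auto simp: feasible_matching_def)
    moreover have "count_list (M (\<sigma> @ [r])) s = Suc (count_list (P \<sigma>) s)"
      using s(1) eq[of \<sigma>] l by (metis count_mset count_add_mset less_imp_le)
    ultimately have "s \<in> free_servers S c (P \<sigma>)"
      using f by (auto simp: feasible_matching_def free_servers_def Suc_le_eq)
    then show ?thesis using s(2) by blast
  qed
  then show ?thesis using P0 by (simp add: online_algorithm_def)
qed

text \<open>
  \<open>E\<close> is the edge set of a trail from \<open>t\<close> to \<open>u\<close> in the multigraph with edges \<open>f i \<rightarrow> g i\<close>; only its
  in- and out-degrees matter below, where \<open>f\<close> and \<open>g\<close> are two matchings and \<open>E\<close> is the set of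
  requests on which they are exchanged.
\<close>

lemma edge_path:
  fixes f g :: "nat \<Rightarrow> 'a"
  assumes "finite I" "(t, u) \<in> ((\<lambda>i. (f i, g i)) ` I)\<^sup>*"
  shows "\<exists>E\<subseteq>I. (\<forall>i\<in>E. (t, f i) \<in> ((\<lambda>i. (f i, g i)) ` I)\<^sup>* \<and> (g i, u) \<in> ((\<lambda>i. (f i, g i)) ` I)\<^sup>*) \<and>
    (\<forall>v. card {i\<in>E. f i = v} + (if v = u then 1 else 0) =
         card {i\<in>E. g i = v} + (if v = t then 1 else (0::nat)))"
  using assms
proof (induction I arbitrary: t u rule: finite_induct)
  case empty
  then show ?case by auto
next
  case (insert a I)
  let ?R = "\<lambda>I. ((\<lambda>i. (f i, g i)) ` I)\<^sup>*"
  have sub: "?R I \<subseteq> ?R (insert a I)" by (intro rtrancl_mono) auto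
  show ?case
  proof (cases "(t, u) \<in> ?R I")
    case True
    from insert.IH[OF this] show ?thesis using sub by (meson subset_insertI2 subsetD)
  next
    case False
    then have ta: "(t, f a) \<in> ?R I" and au: "(g a, u) \<in> ?R I"
      using insert.prems by (auto simp: rtrancl_insert)
    obtain E1 where E1: "E1 \<subseteq> I" "\<And>i. i\<in>E1 \<Longrightarrow> (t, f i) \<in> ?R I \<and> (g i, f a) \<in> ?R I"
      "\<And>v. card {i\<in>E1. f i = v} + (if v = f a then 1 else 0) =
         card {i\<in>E1. g i = v} + (if v = t then 1 else (0::nat))"
      using insert.IH[OF ta] by auto
    obtain E2 where E2: "E2 \<subseteq> I" "\<And>i. i\<in>E2 \<Longrightarrow> (g a, f i) \<in> ?R I \<and> (g i, u) \<in> ?R I"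
      "\<And>v. card {i\<in>E2. f i = v} + (if v = u then 1 else 0) =
         card {i\<in>E2. g i = v} + (if v = g a then 1 else (0::nat))"
      using insert.IH[OF au] by auto
    have fin: "finite E1" "finite E2" using E1(1) E2(1) insert.hyps(1) by (auto intro: finite_subset)
    have edge: "(f i, g i) \<in> ?R I" if "i \<in> I" for i using that by auto
    have disj: "E1 \<inter> E2 = {}"
    proof (rule ccontr)
      assume "E1 \<inter> E2 \<noteq> {}"
      then obtain i where "i \<in> E1" "i \<in> E2" by auto
      then have "(t, u) \<in> ?R I" using E1(1,2) E2(2) edge by (meson rtrancl_trans subsetD)
      then show False using False by simp
    qed
    have a: "a \<notin> E1" "a \<notin> E2" using E1(1) E2(1) insert.hyps(2) by auto
    have ea: "(f a, g a) \<in> ?R (insert a I)" by auto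
    define E where "E = insert a (E1 \<union> E2)"
    have c: "card {i\<in>E. h i = v} = card {i\<in>E1. h i = v} + card {i\<in>E2. h i = v} +
        (if h a = v then 1 else 0)" for h :: "nat \<Rightarrow> 'a" and v
    proof -
      have "{i\<in>E. h i = v} = {i\<in>E1. h i = v} \<union> {i\<in>E2. h i = v} \<union> (if h a = v then {a} else {})"
        by (auto simp: E_def)
      moreover have "card \<dots> = card ({i\<in>E1. h i = v} \<union> {i\<in>E2. h i = v}) +
          card (if h a = v then {a} else {})"
        using fin a by (intro card_Un_disjoint) auto
      moreover have "card ({i\<in>E1. h i = v} \<union> {i\<in>E2. h i = v}) =
          card {i\<in>E1. h i = v} + card {i\<in>E2. h i = v}"
        using fin disj by (intro card_Un_disjoint) auto
      ultimately show ?thesis by simp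
    qed
    have "card {i\<in>E. f i = v} + (if v = u then 1 else 0) =
         card {i\<in>E. g i = v} + (if v = t then 1 else (0::nat))" for v
      unfolding c using E1(3)[of v] E2(3)[of v] by (auto split: if_splits)
    moreover have "E \<subseteq> insert a I" using E1(1) E2(1) by (auto simp: E_def)
    moreover have "(t, f i) \<in> ?R (insert a I) \<and> (g i, u) \<in> ?R (insert a I)" if "i \<in> E" for i
    proof -
      have "(t, f a) \<in> ?R (insert a I)" "(g a, u) \<in> ?R (insert a I)" using ta au sub by auto
      then have u: "(g a, u) \<in> ?R (insert a I)" and t: "(t, g a) \<in> ?R (insert a I)"
        and fu: "(f a, u) \<in> ?R (insert a I)"
        using ea by (blast intro: rtrancl_trans)+
      consider "i = a" | "i \<in> E1" | "i \<in> E2" using \<open>i \<in> E\<close> by (auto simp: E_def)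
      then show ?thesis
      proof cases
        case 1
        then show ?thesis using ta u sub by blast
      next
        case 2
        then have "(t, f i) \<in> ?R (insert a I)" "(g i, f a) \<in> ?R (insert a I)"
          using E1(2) sub by blast+
        then show ?thesis using rtrancl_trans[OF _ fu] by blast
      next
        case 3
        then have "(g a, f i) \<in> ?R (insert a I)" "(g i, u) \<in> ?R (insert a I)"
          using E2(2) sub by blast+
        then show ?thesis using rtrancl_trans[OF t] by blast
      qed
    qed
    ultimately show ?thesis by blast
  qed
qed

lemma count_list_card: "count_list xs v = card {i. i < length xs \<and> xs ! i = v}"
  by (simp add: count_list_eq_length_filter length_filter_conv_card eq_commute)

lemma count_list_exchange:
  assumes "E \<subseteq> {..<length xs}"
  shows "count_list (map (\<lambda>i. if i \<in> E then ys ! i else xs ! i) [0..<length xs]) v +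
           card {i\<in>E. xs ! i = v} = count_list xs v + card {i\<in>E. ys ! i = v}"
proof -
  let ?D = "{i. i < length xs \<and> i \<notin> E \<and> xs ! i = v}"
  have E: "finite E" using assms finite_subset by blast
  have "{i. i < length xs \<and> (if i \<in> E then ys ! i else xs ! i) = v} = ?D \<union> {i\<in>E. ys ! i = v}"
    using assms by auto
  moreover have "card (?D \<union> {i\<in>E. ys ! i = v}) = card ?D + card {i\<in>E. ys ! i = v}"
    using E by (intro card_Un_disjoint) auto
  moreover have "{i. i < length xs \<and> xs ! i = v} = ?D \<union> {i\<in>E. xs ! i = v}"
    using assms by auto
  moreover have "card (?D \<union> {i\<in>E. xs ! i = v}) = card ?D + card {i\<in>E. xs ! i = v}"
    using E by (intro card_Un_disjoint) auto
  moreover have "count_list (map (\<lambda>i. if i \<in> E then ys ! i else xs ! i) [0..<length xs]) v =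
      card {i. i < length xs \<and> (if i \<in> E then ys ! i else xs ! i) = v}"
    unfolding count_list_card by (rule arg_cong[where f = card]) auto
  ultimately show ?thesis by (simp only: count_list_card)
qed

lemma optimal_matching_exists:
  assumes "finite S" "\<exists>ms. feasible_matching S c \<sigma> ms"
  shows "\<exists>ms. optimal_matching S c \<sigma> ms"
proof -
  have "finite {ms. feasible_matching S c \<sigma> ms}"
    by (rule finite_subset[OF _ finite_lists_length_eq[OF assms(1), of "length \<sigma>"]])
      (auto simp: feasible_matching_def)
  then show ?thesis
    using ex_is_arg_min_if_finite[of "{ms. feasible_matching S c \<sigma> ms}" "matching_cost \<sigma>"] assms(2)
    by (auto simp: optimal_matching_def)
qed

lemma optimal_matching_augment:
  assumes S: "finite S" and M: "optimal_matching S c \<sigma> M" and len: "length \<sigma> < sum c S"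
  shows "\<exists>N s. optimal_matching S c (\<sigma> @ [r]) N \<and> mset N = add_mset s (mset M)"
proof -
  define n where "n = length \<sigma>"
  have Mf: "feasible_matching S c \<sigma> M"
    and Mmin: "\<And>L. feasible_matching S c \<sigma> L \<Longrightarrow> matching_cost \<sigma> M \<le> matching_cost \<sigma> L"
    using M by (auto simp: optimal_matching_def is_arg_min_def not_less)
  have "\<exists>N. optimal_matching S c (\<sigma> @ [r]) N"
    using free_servers_nonempty[OF S Mf len] feasible_matching_snoc[OF Mf]
    by (intro optimal_matching_exists[OF S]) blast
  then obtain N where N: "optimal_matching S c (\<sigma> @ [r]) N"
    and least: "\<And>L. optimal_matching S c (\<sigma> @ [r]) L \<Longrightarrow>
      size (mset M - mset N) \<le> size (mset M - mset L)"
    using ex_has_least_nat[of "optimal_matching S c (\<sigma> @ [r])" _ "\<lambda>L. size (mset M - mset L)"]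
    by blast
  have Nf: "feasible_matching S c (\<sigma> @ [r]) N"
    and Nmin: "\<And>L. feasible_matching S c (\<sigma> @ [r]) L \<Longrightarrow>
      matching_cost (\<sigma> @ [r]) N \<le> matching_cost (\<sigma> @ [r]) L"
    using N by (auto simp: optimal_matching_def is_arg_min_def not_less)
  have lM: "length M = n" and lN: "length N = Suc n"
    using Mf Nf by (auto simp: feasible_matching_def n_def)
  have "mset M \<subseteq># mset N"
  proof (rule ccontr)
    assume "\<not> mset M \<subseteq># mset N"
    then obtain t where t: "count_list N t < count_list M t"
      by (auto simp: subseteq_mset_def count_mset not_le)
    let ?R = "((\<lambda>i. (M ! i, N ! i)) ` {..<n})\<^sup>*"
    define R where "R = {u. (t, u) \<in> ?R}"
    define a where "a v = card {i\<in>{..<n}. M ! i = v}" for v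
    define b where "b v = card {i\<in>{..<n}. N ! i = v}" for v
    have a: "count_list M v = a v" for v using lM by (simp add: a_def count_list_card)
    have b: "b v \<le> count_list N v" for v
      unfolding b_def count_list_card lN by (intro card_mono) auto
    have "R \<subseteq> insert t ((!) N ` {..<n})"
      by (auto simp: R_def elim: rtranclE)
    then have R: "finite R" by (rule finite_subset) simp
    have RR: "N ! i \<in> R" if "i < n" "M ! i \<in> R" for i
    proof -
      have "(M ! i, N ! i) \<in> (\<lambda>i. (M ! i, N ! i)) ` {..<n}" using that by auto
      then show ?thesis using that unfolding R_def by (auto intro: rtrancl_into_rtrancl)
    qed
    have sum_card: "(\<Sum>v\<in>R. card {i\<in>{..<n}. h i = v}) = card {i\<in>{..<n}. h i \<in> R}"
      for h :: "nat \<Rightarrow> real"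
    proof -
      have "card (\<Union>v\<in>R. {i\<in>{..<n}. h i = v}) = (\<Sum>v\<in>R. card {i\<in>{..<n}. h i = v})"
        using R by (intro card_UN_disjoint) auto
      moreover have "(\<Union>v\<in>R. {i\<in>{..<n}. h i = v}) = {i\<in>{..<n}. h i \<in> R}" by auto
      ultimately show ?thesis by simp
    qed
    have "sum a R \<le> sum b R"
      unfolding a_def b_def sum_card using RR by (intro card_mono) auto
    moreover have tR: "t \<in> R" "b t < a t" using t a[of t] b[of t] by (auto simp: R_def)
    ultimately obtain u where u: "u \<in> R" "a u < b u"
      using sum_strict_mono_ex1[of R b a] R by (meson leD le_less_linear)
    then have ut: "u \<noteq> t" using tR by auto
    have "(t, u) \<in> ?R" using u by (simp add: R_def)
    from edge_path[OF _ this] obtain E where E: "E \<subseteq> {..<n}"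
      and cE: "\<And>v. card {i\<in>E. M ! i = v} + (if v = u then 1 else 0) =
         card {i\<in>E. N ! i = v} + (if v = t then 1 else 0)"
      by auto
    define M' where "M' = map (\<lambda>i. if i \<in> E then N ! i else M ! i) [0..<n]"
    define N' where "N' = map (\<lambda>i. if i \<in> E then M ! i else N ! i) [0..<Suc n]"
    have cM: "count_list M' v + (if v = t then 1 else 0) = count_list M v + (if v = u then 1 else 0)" for v
      using count_list_exchange[of E M N v] cE[of v] E lM by (auto simp: M'_def split: if_splits)
    have cN: "count_list N' v + (if v = u then 1 else 0) = count_list N v + (if v = t then 1 else 0)" for v
      using count_list_exchange[of E N M v, unfolded lN lessThan_Suc, OF subset_insertI2[OF E]] cE[of v]
      by (auto simp: N'_def split: if_splits simp del: upt_Suc)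
    have elM: "i < n \<Longrightarrow> M ! i \<in> S" and elN: "i \<le> n \<Longrightarrow> N ! i \<in> S" for i
      using Mf Nf lM lN by (auto simp: feasible_matching_def subset_iff less_Suc_eq_le)
    have capM: "v \<in> S \<Longrightarrow> count_list M v \<le> c v" and capN: "v \<in> S \<Longrightarrow> count_list N v \<le> c v" for v
      using Mf Nf by (auto simp: feasible_matching_def)
    have "count_list M' v \<le> c v" if "v \<in> S" for v
      using cM[of v] capM[OF that] capN[OF that] a[of v] b[of v] u by (auto split: if_splits)
    then have "feasible_matching S c \<sigma> M'"
      using elM elN E by (auto simp: feasible_matching_def M'_def n_def[symmetric])
    then have 1: "matching_cost \<sigma> M \<le> matching_cost \<sigma> M'" by (rule Mmin)
    have "count_list N' v \<le> c v" if "v \<in> S" for v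
      using cN[of v] capM[OF that] capN[OF that] t by (auto split: if_splits)
    then have N'f: "feasible_matching S c (\<sigma> @ [r]) N'"
      using elM elN E by (auto simp: feasible_matching_def N'_def n_def[symmetric] simp del: upt_Suc)
    have "n \<notin> E" using E by auto
    then have "matching_cost \<sigma> M' + matching_cost (\<sigma> @ [r]) N' =
        matching_cost \<sigma> M + matching_cost (\<sigma> @ [r]) N"
      by (simp add: matching_cost_def M'_def N'_def n_def[symmetric] nth_append
          sum.distrib[symmetric] del: upt_Suc) (auto simp: nth_append intro!: sum.cong)
    then have "optimal_matching S c (\<sigma> @ [r]) N'"
      using 1 N'f Nmin unfolding optimal_matching_def is_arg_min_def
      by (smt (verit))
    then have le: "size (mset M - mset N) \<le> size (mset M - mset N')" by (rule least)
    have "mset M - mset N' \<subseteq># mset M - mset N"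
    proof (rule mset_subset_eqI)
      fix v show "count (mset M - mset N') v \<le> count (mset M - mset N) v"
        using cN[of v] a[of v] b[of v] u by (auto simp: count_mset split: if_splits)
    qed
    moreover have "count (mset M - mset N') t < count (mset M - mset N) t"
      using cN[of t] t ut by (auto simp: count_mset)
    ultimately have "mset M - mset N' \<subset># mset M - mset N"
      by (metis nless_le subset_mset.le_imp_less_or_eq)
    then show False using mset_subset_size le by (metis not_less)
  qed
  moreover have "size (mset N - mset M) = 1"
    using calculation lM lN by (simp add: size_Diff_submset)
  then obtain s where "mset N - mset M = {#s#}" using size_1_singleton_mset[of "mset N - mset M"] by auto
  ultimately have "mset N = add_mset s (mset M)"
    by (metis add_mset_add_single subset_mset.add_diff_inverse)
  then show ?thesis using N by blast
qed

lemma permutation_algorithm_exists: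
  assumes "ofal_instance S c"
  shows "\<exists>P. permutation_algorithm S c P"
proof -
  have S: "finite S" using assms by (simp add: ofal_instance_def)
  define nx where "nx xs m r =
    (SOME N. \<exists>s. optimal_matching S c (xs @ [r]) N \<and> mset N = add_mset s (mset m))" for xs m r
  define M where "M \<sigma> = rec_list [] (\<lambda>r xs m. nx (rev xs) m r) (rev \<sigma>)" for \<sigma>
  define P where "P \<sigma> = rec_list []
    (\<lambda>r xs m. m @ [SOME s. mset (M (rev xs @ [r])) = add_mset s (mset (M (rev xs)))]) (rev \<sigma>)"
    for \<sigma>
  have nxt: "optimal_matching S c (\<sigma> @ [r]) (nx \<sigma> m r) \<and>
      (\<exists>s. mset (nx \<sigma> m r) = add_mset s (mset m))"
    if "optimal_matching S c \<sigma> m" "length \<sigma> < sum c S" for \<sigma> m r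
  proof -
    have "\<exists>N. \<exists>s. optimal_matching S c (\<sigma> @ [r]) N \<and> mset N = add_mset s (mset m)"
      using optimal_matching_augment[OF S that] by blast
    from someI_ex[OF this] show ?thesis unfolding nx_def by blast
  qed
  have M0: "M [] = []" and Msnoc: "M (\<sigma> @ [r]) = nx \<sigma> (M \<sigma>) r" for \<sigma> r
    by (simp_all add: M_def)
  have P0: "P [] = []"
    and Psnoc: "P (\<sigma> @ [r]) = P \<sigma> @ [SOME s. mset (M (\<sigma> @ [r])) = add_mset s (mset (M \<sigma>))]" for \<sigma> r
    by (simp_all add: P_def)
  have opt: "length \<sigma> \<le> sum c S \<Longrightarrow> optimal_matching S c \<sigma> (M \<sigma>)" for \<sigma>
  proof (induction \<sigma> rule: rev_induct)
    case Nil
    then show ?case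
      by (auto simp: M0 optimal_matching_def is_arg_min_def feasible_matching_def matching_cost_def)
  next
    case (snoc r \<sigma>)
    then show ?case using nxt[of \<sigma> "M \<sigma>" r] by (simp add: Msnoc)
  qed
  have "\<exists>s. mset (M (\<sigma> @ [r])) = add_mset s (mset (M \<sigma>)) \<and> P (\<sigma> @ [r]) = P \<sigma> @ [s]"
    if "length \<sigma> < sum c S" for \<sigma> r
  proof -
    have "\<exists>s. mset (M (\<sigma> @ [r])) = add_mset s (mset (M \<sigma>))"
      using nxt[OF opt that] that by (simp add: Msnoc)
    from someI_ex[OF this] show ?thesis by (simp add: Psnoc)
  qed
  then have "permutation_algorithm S c P"
    unfolding permutation_algorithm_def using opt P0 by blast
  then show ?thesis by blast
qed

end

theory Submission
  imports Defs
begin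

text \<open>
  Upper bound. Let \<open>\<rho>\<close> bound the ratio of the diameter to the widest gap over all sets of consecutive
  servers. Then PTCP is \<open>(1 + 2\<rho>)\<close>-competitive. Let \<open>f\<close> and \<open>g\<close> be the capacities left by PTCP and by
  an optimal matching. The potential is the cost of transporting \<open>f\<close> to \<open>g\<close>, plus twice the length of
  the detours in the wrong direction which PTCP can still be forced to make because it exhausts a
  node of its tree before it leaves the node. If PTCP serves at \<open>s\<close> a request which the optimum serves
  at \<open>t\<close>, then the potential pays for \<open>\<bar>s - t\<bar>\<close>, unless PTCP preferred \<open>s\<close> to a free server beyond a
  threshold; in that case the optimum pays the distance from the threshold to \<open>t\<close>, which the position
  of the threshold makes large enough. For \<open>\<delta> < 1\<close> one can take \<open>\<rho> = 1 / (1 - \<delta>)\<close>; for \<open>\<delta> > 1\<close> the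
  hypothesis forces \<open>\<epsilon> > 4k\<close>, and \<open>\<rho> = 2k - 1\<close>, valid for any \<open>2k\<close> servers, suffices.

  Lower bound. The adversary fills each server up to one place at no cost, requests \<open>\<delta>\<^sup>k / 2\<close>, and
  then always the server used last. The set of used servers grows alternately to the right and to
  the left, so each of the last \<open>2k - 1\<close> requests costs at least \<open>2\<close>, while the optimum shifts half of
  the requests outwards by one server.
\<close>

section \<open>The potential\<close>

definition excess :: "real set \<Rightarrow> (real \<Rightarrow> int) \<Rightarrow> (real \<Rightarrow> int) \<Rightarrow> real \<Rightarrow> int" where
  "excess S f g \<gamma> = (\<Sum>t\<in>{t\<in>S. t < \<gamma>}. g t - f t)"

text \<open>
  An upper bound on how often the gap \<open>\<delta>\<close>, inside the left half \<open>[lo \<gamma>, \<gamma>)\<close> of the node of \<open>\<gamma>\<close>, still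
  has to be crossed to the left by requests that are bound to end up to the right of \<open>\<gamma>\<close>: such a
  request fills a free server left of \<open>\<delta>\<close> although the optimum serves it between \<open>\<delta>\<close> and \<open>\<gamma>\<close>.
  Nothing is charged once the right half is full, because then requests no longer leave to the
  right at this node.
\<close>

definition backlog :: "real set \<Rightarrow> (real \<Rightarrow> real) \<Rightarrow> (real \<Rightarrow> real) \<Rightarrow>
    (real \<Rightarrow> int) \<Rightarrow> (real \<Rightarrow> int) \<Rightarrow> real \<Rightarrow> real \<Rightarrow> int" where
  "backlog S lo hi f g \<gamma> \<delta> =
     (if lo \<gamma> < \<delta> \<and> \<delta> < \<gamma> \<and> (\<exists>t\<in>S. \<gamma> < t \<and> t \<le> hi \<gamma> \<and> 0 < f t)
      then max 0 (min (min (sum f {t\<in>S. lo \<gamma> \<le> t \<and> t < \<delta>}) (sum g {t\<in>S. \<delta> < t \<and> t < \<gamma>}))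
                      (excess S f g \<gamma>))
      else 0)"

text \<open>Interval ends and widths are arguments rather than locale constants, so that the same
  term can be evaluated in the reflected instance.\<close>

definition detour :: "real set \<Rightarrow> real set \<Rightarrow> (real \<Rightarrow> real) \<Rightarrow> (real \<Rightarrow> real) \<Rightarrow> (real \<Rightarrow> real) \<Rightarrow>
    (real \<Rightarrow> int) \<Rightarrow> (real \<Rightarrow> int) \<Rightarrow> real" where
  "detour S G lo hi w f g =
     (\<Sum>\<delta>\<in>G. w \<delta> * real_of_int (\<Sum>\<gamma>\<in>G. backlog S lo hi f g \<gamma> \<delta>))"

text \<open>On a line, when the totals agree, the least transport cost is the sum over all gaps of
  the width times the net flow across the gap; \<open>excess\<close> is this flow.\<close>

definition transport :: "real set \<Rightarrow> real set \<Rightarrow> (real \<Rightarrow> real) \<Rightarrow>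
    (real \<Rightarrow> int) \<Rightarrow> (real \<Rightarrow> int) \<Rightarrow> real" where
  "transport S G w f g = (\<Sum>\<delta>\<in>G. w \<delta> * real_of_int \<bar>excess S f g \<delta>\<bar>)"

section \<open>Effect of one served request on capacity sums and excess\<close>

lemma sum_decr:
  fixes f :: "'a \<Rightarrow> int"
  assumes "finite A"
  shows "sum (f(s := f s - 1)) A = sum f A - (if s \<in> A then 1 else 0)"
proof -
  have "sum (f(s := f s - 1)) A = (\<Sum>x\<in>A. f x - (if x = s then 1 else 0))"
    by (intro sum.cong) auto
  then show ?thesis using assms by (simp add: sum_subtractf sum.delta)
qed

lemma excess_decr:
  assumes "finite S" "s \<in> S" "t \<in> S"
  shows "excess S (f(s := f s - 1)) (g(t := g t - 1)) \<gamma> =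
    excess S f g \<gamma> + (if s < \<gamma> then 1 else 0) - (if t < \<gamma> then 1 else 0)"
  using assms by (simp add: excess_def sum_subtractf sum_decr del: fun_upd_apply)

text \<open>
  A binary tree of nested intervals of servers. The inner nodes are named by their thresholds
  \<open>\<gamma> \<in> G\<close>: the node of \<open>\<gamma>\<close> spans \<open>[lo \<gamma>, hi \<gamma>]\<close> and is cut in the gap between the consecutive servers
  \<open>lf \<gamma>\<close> and \<open>rt \<gamma>\<close>. Every gap is cut by exactly one node.
\<close>

locale gap_hierarchy =
  fixes S G :: "real set" and lo hi lf rt :: "real \<Rightarrow> real" and \<rho> :: real
  assumes finite_S: "finite S" and finite_G: "finite G"
    and lo_in: "\<gamma> \<in> G \<Longrightarrow> lo \<gamma> \<in> S" and hi_in: "\<gamma> \<in> G \<Longrightarrow> hi \<gamma> \<in> S"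
    and lf_in: "\<gamma> \<in> G \<Longrightarrow> lf \<gamma> \<in> S" and rt_in: "\<gamma> \<in> G \<Longrightarrow> rt \<gamma> \<in> S"
    and lo_le_lf: "\<gamma> \<in> G \<Longrightarrow> lo \<gamma> \<le> lf \<gamma>" and rt_le_hi: "\<gamma> \<in> G \<Longrightarrow> rt \<gamma> \<le> hi \<gamma>"
    and lf_less: "\<gamma> \<in> G \<Longrightarrow> lf \<gamma> < \<gamma>" and less_rt: "\<gamma> \<in> G \<Longrightarrow> \<gamma> < rt \<gamma>"
    and adjacent: "\<gamma> \<in> G \<Longrightarrow> t \<in> S \<Longrightarrow> t \<le> lf \<gamma> \<or> rt \<gamma> \<le> t"
    and dist: "s \<in> S \<Longrightarrow> t \<in> S \<Longrightarrow> s \<le> t \<Longrightarrow> t - s = (\<Sum>\<gamma>\<in>{\<gamma>\<in>G. s < \<gamma> \<and> \<gamma> < t}. rt \<gamma> - lf \<gamma>)"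
    and split: "s \<in> S \<Longrightarrow> t \<in> S \<Longrightarrow> s < t \<Longrightarrow> \<exists>\<gamma>\<in>G. lo \<gamma> \<le> s \<and> s < \<gamma> \<and> \<gamma> < t \<and> t \<le> hi \<gamma>"
    and laminar: "u \<in> G \<Longrightarrow> v \<in> G \<Longrightarrow> u < v \<Longrightarrow>
      hi u < lo v \<or> lo v \<le> lo u \<and> hi u < v \<or> u < lo v \<and> hi v \<le> hi u"
    and ratio_rt: "\<gamma> \<in> G \<Longrightarrow> rt \<gamma> - lo \<gamma> \<le> (1 + \<rho>) * (rt \<gamma> - \<gamma>)"
    and ratio_lf: "\<gamma> \<in> G \<Longrightarrow> hi \<gamma> - lf \<gamma> \<le> (1 + \<rho>) * (\<gamma> - lf \<gamma>)"
    and ratio: "\<gamma> \<in> G \<Longrightarrow> hi \<gamma> - lo \<gamma> \<le> \<rho> * (rt \<gamma> - lf \<gamma>)"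
    and rho_ge_1: "1 \<le> \<rho>"
begin

section \<open>Gap widths, and the backlog under one served request\<close>

definition w :: "real \<Rightarrow> real" where "w \<gamma> = rt \<gamma> - lf \<gamma>"

abbreviation "bl \<equiv> backlog S lo hi"
abbreviation "ex \<equiv> excess S"

lemma w_pos: "\<gamma> \<in> G \<Longrightarrow> 0 < w \<gamma>"
  using lf_less[of \<gamma>] less_rt[of \<gamma>] by (simp add: w_def)

text \<open>Lengths written as sums over all of \<open>G\<close> can be compared gap by gap.\<close>

lemma dist_indicator:
  assumes "s \<in> S" "t \<in> S" "s \<le> t"
  shows "(\<Sum>\<gamma>\<in>G. w \<gamma> * (if s < \<gamma> \<and> \<gamma> < t then 1 else 0)) = t - s"
proof -
  have "(\<Sum>\<gamma>\<in>G. w \<gamma> * (if s < \<gamma> \<and> \<gamma> < t then 1 else 0)) = (\<Sum>\<gamma>\<in>G. if s < \<gamma> \<and> \<gamma> < t then w \<gamma> else 0)"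
    by (intro sum.cong) auto
  also have "\<dots> = (\<Sum>\<gamma>\<in>{\<gamma>\<in>G. s < \<gamma> \<and> \<gamma> < t}. w \<gamma>)"
    using finite_G by (simp only: sum.inter_filter)
  finally show ?thesis using dist[OF assms] by (simp add: w_def)
qed

text \<open>Both capacity sums in the minimum can only fall, and a threshold with free servers to
  its right had some before. So a backlog grows at most as much as the excess at
  \<open>\<gamma>\<close>, and only where it is not switched off.\<close>

lemma bl_update_le:
  assumes "s \<in> S" "t \<in> S" and e: "ex (f(s := f s - 1)) (g(t := g t - 1)) \<gamma> \<le> ex f g \<gamma> + d" "0 \<le> d"
    and d: "lo \<gamma> < \<delta> \<Longrightarrow> \<delta> < \<gamma> \<Longrightarrow> \<exists>t\<in>S. \<gamma> < t \<and> t \<le> hi \<gamma> \<and> 0 < f t \<Longrightarrow> d \<le> d'" "0 \<le> d'"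
  shows "bl (f(s := f s - 1)) (g(t := g t - 1)) \<gamma> \<delta> \<le> bl f g \<gamma> \<delta> + d'"
proof -
  let ?f = "f(s := f s - 1)" and ?g = "g(t := g t - 1)"
  let ?A = "{t\<in>S. lo \<gamma> \<le> t \<and> t < \<delta>}" and ?B = "{t\<in>S. \<delta> < t \<and> t < \<gamma>}"
  have 1: "sum ?f ?A \<le> sum f ?A" "sum ?g ?B \<le> sum g ?B"
    using finite_S by (simp_all add: sum_decr del: fun_upd_apply)
  show ?thesis
  proof (cases "lo \<gamma> < \<delta> \<and> \<delta> < \<gamma> \<and> (\<exists>t\<in>S. \<gamma> < t \<and> t \<le> hi \<gamma> \<and> 0 < ?f t)")
    case True
    then have 2: "lo \<gamma> < \<delta> \<and> \<delta> < \<gamma> \<and> (\<exists>t\<in>S. \<gamma> < t \<and> t \<le> hi \<gamma> \<and> 0 < f t)"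
      by (auto split: if_splits intro: less_trans)
    then have "d \<le> d'" using d by blast
    then show ?thesis unfolding backlog_def if_P[OF True] if_P[OF 2]
      using 1 e by linarith
  next
    case False
    then show ?thesis using d(2) unfolding backlog_def if_not_P[OF False] by simp
  qed
qed

abbreviation active where "active f \<gamma> \<equiv> \<exists>t\<in>S. \<gamma> < t \<and> t \<le> hi \<gamma> \<and> 0 < f t"

lemma gap_not_server: "\<gamma> \<in> G \<Longrightarrow> t \<in> S \<Longrightarrow> \<gamma> \<noteq> t"
  using adjacent[of \<gamma> t] lf_less[of \<gamma>] less_rt[of \<gamma>] by auto

text \<open>The excess at \<open>\<gamma>\<close> rises only if \<open>s < \<gamma> < t\<close>, and
  without free servers in the right half the backlog is 0 anyway.\<close>

lemma bl_mono:
  assumes "\<gamma> \<in> G" "s \<in> S" "t \<in> S" "\<not> (s < \<gamma> \<and> \<gamma> < t \<and> active f \<gamma>)"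
  shows "bl (f(s := f s - 1)) (g(t := g t - 1)) \<gamma> \<delta> \<le> bl f g \<gamma> \<delta>"
proof -
  have "bl (f(s := f s - 1)) (g(t := g t - 1)) \<gamma> \<delta> \<le> bl f g \<gamma> \<delta> + 0"
    by (rule bl_update_le[OF assms(2,3), where d = "if s < \<gamma> \<and> \<gamma> < t then 1 else 0"])
      (use assms gap_not_server[OF assms(1,3)] in \<open>auto simp: excess_decr finite_S simp del: fun_upd_apply\<close>)
  then show ?thesis by simp
qed

lemma bl_mono1:
  assumes "s \<in> S" "t \<in> S"
  shows "bl (f(s := f s - 1)) (g(t := g t - 1)) \<gamma> \<delta> \<le> bl f g \<gamma> \<delta> + (if lo \<gamma> < \<delta> \<and> \<delta> < \<gamma> then 1 else 0)"
proof (cases "lo \<gamma> < \<delta> \<and> \<delta> < \<gamma>")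
  case True
  have "bl (f(s := f s - 1)) (g(t := g t - 1)) \<gamma> \<delta> \<le> bl f g \<gamma> \<delta> + 1"
    by (rule bl_update_le[OF assms, where d = 1])
      (use assms in \<open>auto simp: excess_decr finite_S simp del: fun_upd_apply\<close>)
  then show ?thesis using True by simp
next
  case False
  then show ?thesis by (auto simp: backlog_def)
qed

text \<open>No threshold satisfies \<open>s < \<gamma> < t\<close>. Requests served to the right of
  the optimum's server can raise only the reflected detour term.\<close>

lemma detour_mono:
  assumes "s \<in> S" "t \<in> S" "t \<le> s"
  shows "detour S G lo hi w (f(s := f s - 1)) (g(t := g t - 1)) \<le> detour S G lo hi w f g"
  unfolding detour_def
proof (intro sum_mono mult_left_mono of_int_le_iff[THEN iffD2])
  fix \<delta> \<gamma> assume "\<gamma> \<in> G"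
  show "bl (f(s := f s - 1)) (g(t := g t - 1)) \<gamma> \<delta> \<le> bl f g \<gamma> \<delta>"
    by (rule bl_mono) (use assms \<open>\<gamma> \<in> G\<close> in auto)
next
  fix \<delta> assume "\<delta> \<in> G"
  then show "0 \<le> w \<delta>" using w_pos[of \<delta>] by simp
qed

text \<open>Bookkeeping: \<open>t - s\<close> is spread over the gaps between \<open>s\<close> and
  \<open>t\<close>, so that the amortised cost becomes a sum with one integer coefficient per gap,
  to be bounded gap by gap.\<close>

lemma potential_step:
  fixes f g f' g' :: "real \<Rightarrow> int"
  assumes "s \<in> S" "t \<in> S" "s \<le> t"
  shows "(t - s) + transport S G w f' g' + 2 * detour S G lo hi w f' g' =
    transport S G w f g + 2 * detour S G lo hi w f g +
    (\<Sum>\<delta>\<in>G. w \<delta> * real_of_int ((if s < \<delta> \<and> \<delta> < t then 1 else 0) + (\<bar>ex f' g' \<delta>\<bar> - \<bar>ex f g \<delta>\<bar>) +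
        2 * ((\<Sum>\<gamma>\<in>G. bl f' g' \<gamma> \<delta>) - (\<Sum>\<gamma>\<in>G. bl f g \<gamma> \<delta>))))"
proof -
  have "(\<Sum>\<delta>\<in>G. w \<delta> * real_of_int ((if s < \<delta> \<and> \<delta> < t then 1 else 0) + (\<bar>ex f' g' \<delta>\<bar> - \<bar>ex f g \<delta>\<bar>) +
        2 * ((\<Sum>\<gamma>\<in>G. bl f' g' \<gamma> \<delta>) - (\<Sum>\<gamma>\<in>G. bl f g \<gamma> \<delta>)))) =
     (\<Sum>\<delta>\<in>G. w \<delta> * (if s < \<delta> \<and> \<delta> < t then 1 else 0) +
        (w \<delta> * real_of_int \<bar>ex f' g' \<delta>\<bar> - w \<delta> * real_of_int \<bar>ex f g \<delta>\<bar>) +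
        2 * (w \<delta> * real_of_int (\<Sum>\<gamma>\<in>G. bl f' g' \<gamma> \<delta>) - w \<delta> * real_of_int (\<Sum>\<gamma>\<in>G. bl f g \<gamma> \<delta>)))"
    by (intro sum.cong refl) (simp add: algebra_simps)
  also have "\<dots> = (t - s) + (transport S G w f' g' - transport S G w f g) +
      2 * (detour S G lo hi w f' g' - detour S G lo hi w f g)"
    unfolding transport_def detour_def
    by (simp only: sum.distrib sum_subtractf sum_distrib_left[symmetric] dist_indicator[OF assms])
  finally show ?thesis by simp
qed

section \<open>Requests served to the left of the optimum's server\<close>

lemma excess_split:
  assumes "\<delta> \<in> G" "\<delta> < \<gamma>"
  shows "ex f g \<gamma> = ex f g \<delta> + (sum g {t\<in>S. \<delta> < t \<and> t < \<gamma>} - sum f {t\<in>S. \<delta> < t \<and> t < \<gamma>})"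
proof -
  have "{t\<in>S. t < \<gamma>} = {t\<in>S. t < \<delta>} \<union> {t\<in>S. \<delta> < t \<and> t < \<gamma>}"
    using assms gap_not_server[OF assms(1)] by force
  then have "ex f g \<gamma> = (\<Sum>t\<in>{t\<in>S. t < \<delta>} \<union> {t\<in>S. \<delta> < t \<and> t < \<gamma>}. g t - f t)"
    by (simp add: excess_def)
  also have "\<dots> = ex f g \<delta> + (\<Sum>t\<in>{t\<in>S. \<delta> < t \<and> t < \<gamma>}. g t - f t)"
    unfolding excess_def using finite_S by (intro sum.union_disjoint) auto
  finally show ?thesis by (simp add: sum_subtractf)
qed

text \<open>
  If \<open>s < t\<close> and \<open>n\<^sub>\<delta> := excess S f g \<delta> < 0\<close>, then serving at \<open>s\<close> what the optimum serves at \<open>t\<close>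
  shrinks the transport term at \<open>\<delta>\<close>. If \<open>n\<^sub>\<delta> \<ge> 0\<close>, there are free servers beyond the full node that
  contains \<open>s\<close> and \<open>t\<close>, and the backlog of the first threshold before them drops by one.
\<close>

lemma step_inactive:
  fixes f g :: "real \<Rightarrow> int"
  assumes st: "s \<in> S" "t \<in> S" "s < t"
    and f0: "\<And>x. x \<in> S \<Longrightarrow> 0 \<le> f x" and g0: "\<And>x. x \<in> S \<Longrightarrow> 0 \<le> g x"
    and f1: "1 \<le> f s" and g1: "1 \<le> g t" and tot: "sum f S = sum g S"
    and inactive: "\<And>\<gamma>. \<gamma> \<in> G \<Longrightarrow> s < \<gamma> \<Longrightarrow> \<gamma> < t \<Longrightarrow> \<not> active f \<gamma>"
  shows "(t - s) + transport S G w (f(s := f s - 1)) (g(t := g t - 1)) +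
      2 * detour S G lo hi w (f(s := f s - 1)) (g(t := g t - 1)) \<le>
    transport S G w f g + 2 * detour S G lo hi w f g"
proof -
  let ?f = "f(s := f s - 1)" and ?g = "g(t := g t - 1)"
  obtain u where u: "u \<in> G" "lo u \<le> s" "s < u" "u < t" "t \<le> hi u"
    using split[OF st] by blast
  have full: "f x = 0" if x: "x \<in> S" "s < x" "x \<le> hi u" for x
  proof (cases "x \<le> t")
    case True
    obtain v where "v \<in> G" "s < v" "v < x" "x \<le> hi v" using split[OF st(1) x(1,2)] by blast
    then show ?thesis using inactive[of v] x True f0[OF x(1)] by force
  next
    case False
    then show ?thesis using inactive[OF u(1,3,4)] x u f0[OF x(1)] by force
  qed
  have c: "(if s < \<delta> \<and> \<delta> < t then 1 else 0) + (\<bar>ex ?f ?g \<delta>\<bar> - \<bar>ex f g \<delta>\<bar>) +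
        2 * ((\<Sum>\<gamma>\<in>G. bl ?f ?g \<gamma> \<delta>) - (\<Sum>\<gamma>\<in>G. bl f g \<gamma> \<delta>)) \<le> 0" (is "?c \<delta> \<le> 0") if \<delta>: "\<delta> \<in> G" for \<delta>
  proof -
    have mono: "bl ?f ?g \<gamma> \<delta> \<le> bl f g \<gamma> \<delta>" if "\<gamma> \<in> G" for \<gamma>
      by (rule bl_mono) (use that st inactive in auto)
    then have le: "(\<Sum>\<gamma>\<in>G. bl ?f ?g \<gamma> \<delta>) \<le> (\<Sum>\<gamma>\<in>G. bl f g \<gamma> \<delta>)" by (rule sum_mono)
    have e: "ex ?f ?g \<delta> = ex f g \<delta> + (if s < \<delta> then 1 else 0) - (if t < \<delta> then 1 else 0)"
      by (rule excess_decr[OF finite_S st(1,2)])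
    consider "\<not> (s < \<delta> \<and> \<delta> < t)" | "s < \<delta>" "\<delta> < t" "ex f g \<delta> < 0" | "s < \<delta>" "\<delta> < t" "0 \<le> ex f g \<delta>"
      by linarith
    then show ?thesis
    proof cases
      case 1
      then show ?thesis using e le st gap_not_server[OF \<delta> st(2)] by auto
    next
      case 2
      then show ?thesis using e le by auto
    next
      case 3
      \<comment> \<open>Otherwise PTCP has no capacity left to the right of \<open>\<delta>\<close>
        while the optimum has some at \<open>t\<close>. Since the totals agree, the excess at
        \<open>\<delta>\<close> would be negative.\<close>
      have "{x\<in>S. hi u < x \<and> 0 < f x} \<noteq> {}"
      proof
        assume none: "{x\<in>S. hi u < x \<and> 0 < f x} = {}"
        have "f x = 0" if "x \<in> S" "\<delta> < x" for x
          using none full[of x] f0[of x] that 3 by force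
        then have 1: "sum f {x\<in>S. \<delta> < x} = 0" by (intro sum.neutral) auto
        have "g t \<le> sum g {x\<in>S. \<delta> < x}"
          using st 3 g0 finite_S by (intro member_le_sum) auto
        moreover have "sum h S = sum h {x\<in>S. x < \<delta>} + sum h {x\<in>S. \<delta> < x}" for h :: "real \<Rightarrow> int"
        proof -
          have "S = {x\<in>S. x < \<delta>} \<union> {x\<in>S. \<delta> < x}" using gap_not_server[OF \<delta>] by force
          then have "sum h S = sum h ({x\<in>S. x < \<delta>} \<union> {x\<in>S. \<delta> < x})" by simp
          also have "\<dots> = sum h {x\<in>S. x < \<delta>} + sum h {x\<in>S. \<delta> < x}"
            using finite_S by (intro sum.union_disjoint) auto
          finally show ?thesis .
        qed
        ultimately show False
          using 1 3(3) tot g1 unfolding excess_def sum_subtractf by (smt (verit))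
      qed
      define t0 where "t0 = Min {x\<in>S. hi u < x \<and> 0 < f x}"
      have t0: "t0 \<in> S" "hi u < t0" "0 < f t0" and t0_min: "\<And>x. x \<in> S \<Longrightarrow> hi u < x \<Longrightarrow> 0 < f x \<Longrightarrow> t0 \<le> x"
        using Min_in[OF _ \<open>{x\<in>S. hi u < x \<and> 0 < f x} \<noteq> {}\<close>] finite_S by (auto simp: t0_def)
      \<comment> \<open>This threshold separates \<open>t\<close> from the first free server beyond
        the node of \<open>u\<close>; laminarity places that whole node in the left half of the node
        of \<open>v\<close>.\<close>
      obtain v where v: "v \<in> G" "lo v \<le> t" "t < v" "v < t0" "t0 \<le> hi v"
        using split[OF st(2) t0(1)] u t0 by auto
      have lam: "lo v \<le> lo u" "hi u < v"
        using laminar[OF u(1) v(1)] u v t0 by auto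
      have f_zero: "f x = 0" if "x \<in> S" "s < x" "x < v" for x
        using full[of x] t0_min[of x] f0[of x] that v by force
      let ?A = "{x\<in>S. lo v \<le> x \<and> x < \<delta>}" and ?B = "{x\<in>S. \<delta> < x \<and> x < v}"
      have "sum f ?B = 0" using f_zero 3 by (intro sum.neutral) auto
      then have n: "sum g ?B \<le> ex f g v"
        using excess_split[OF \<delta>, of v f g] 3 v by simp
      have sA: "s \<in> ?A" using st 3 lam u by auto
      have tB: "t \<in> ?B" using st 3 v by auto
      have a: "f s \<le> sum f ?A" using sA f0 finite_S by (intro member_le_sum) auto
      have b: "g t \<le> sum g ?B" using tB g0 finite_S by (intro member_le_sum) auto
      have a': "sum ?f ?A = sum f ?A - 1"
        using sA finite_S by (simp add: sum_decr del: fun_upd_apply)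
      have b': "sum ?g ?B = sum g ?B - 1"
        using tB finite_S by (simp add: sum_decr del: fun_upd_apply)
      have act: "lo v < \<delta> \<and> \<delta> < v \<and> active f v" using v t0 lam u 3 by auto
      have "bl ?f ?g v \<delta> \<le> max 0 (min (sum ?f ?A) (sum ?g ?B))"
        unfolding backlog_def by (auto simp del: fun_upd_apply)
      \<comment> \<open>PTCP has no capacity between \<open>\<delta>\<close> and \<open>v\<close>,
        so the excess at \<open>v\<close> does not cut off the minimum: the backlog is the smaller
        of two positive sums, both of which drop by one. Counted twice, the drop pays for the unit
        of \<open>t - s\<close> and for the growth of the transport term.\<close>
      then have "bl ?f ?g v \<delta> + 1 \<le> bl f g v \<delta>"
        unfolding backlog_def[of _ _ _ f g] if_P[OF act] a' b' using a b n f1 g1 by linarith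
      moreover have "(\<Sum>\<gamma>\<in>G - {v}. bl ?f ?g \<gamma> \<delta>) \<le> (\<Sum>\<gamma>\<in>G - {v}. bl f g \<gamma> \<delta>)"
        using mono by (intro sum_mono) auto
      ultimately have "(\<Sum>\<gamma>\<in>G. bl ?f ?g \<gamma> \<delta>) + 1 \<le> (\<Sum>\<gamma>\<in>G. bl f g \<gamma> \<delta>)"
        unfolding sum.remove[OF finite_G v(1)] by linarith
      then show ?thesis using e 3 by auto
    qed
  qed
  have "(\<Sum>\<delta>\<in>G. w \<delta> * real_of_int (?c \<delta>)) \<le> 0"
    by (intro sum_nonpos mult_nonneg_nonpos of_int_le_0_iff[THEN iffD2] c less_imp_le[OF w_pos])
  then show ?thesis using potential_step[OF st(1,2) less_imp_le[OF st(3)], of ?f ?g f g] by linarith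
qed

text \<open>The thresholds in the left half, together with \<open>\<gamma>\<close> itself, cut
  distinct gaps between \<open>lo \<gamma>\<close> and \<open>rt \<gamma>\<close>.\<close>

lemma width_left_of_gap:
  assumes "\<gamma> \<in> G"
  shows "(\<Sum>\<delta>\<in>G. w \<delta> * (if lo \<gamma> < \<delta> \<and> \<delta> < \<gamma> then 1 else 0)) + w \<gamma> \<le> rt \<gamma> - lo \<gamma>"
proof -
  note b = lo_le_lf[OF assms] lf_less[OF assms] less_rt[OF assms]
  have "(\<Sum>\<delta>\<in>G. w \<delta> * (if lo \<gamma> < \<delta> \<and> \<delta> < \<gamma> then 1 else 0)) + w \<gamma> =
      (\<Sum>\<delta>\<in>G. w \<delta> * (if lo \<gamma> < \<delta> \<and> \<delta> < \<gamma> then 1 else 0) + (if \<delta> = \<gamma> then w \<delta> else 0))"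
    using assms finite_G by (simp add: sum.distrib)
  also have "\<dots> \<le> (\<Sum>\<delta>\<in>G. w \<delta> * (if lo \<gamma> < \<delta> \<and> \<delta> < rt \<gamma> then 1 else 0))"
    using b w_pos by (intro sum_mono) (auto intro: less_imp_le)
  also have "\<dots> = rt \<gamma> - lo \<gamma>"
    using assms b by (intro dist_indicator lo_in rt_in) auto
  finally show ?thesis .
qed

lemma width_right_of_gap:
  assumes "\<gamma>\<^sub>1 \<in> G" "t \<in> S" "\<gamma>\<^sub>1 < t"
  shows "(\<Sum>\<gamma>\<in>G. if \<gamma>\<^sub>1 < \<gamma> \<and> \<gamma> < t then w \<gamma> else 0) \<le> t - rt \<gamma>\<^sub>1"
proof -
  note b = lf_less[OF assms(1)] less_rt[OF assms(1)]
  have "(\<Sum>\<gamma>\<in>G. if \<gamma>\<^sub>1 < \<gamma> \<and> \<gamma> < t then w \<gamma> else 0) + w \<gamma>\<^sub>1 =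
      (\<Sum>\<gamma>\<in>G. (if \<gamma>\<^sub>1 < \<gamma> \<and> \<gamma> < t then w \<gamma> else 0) + (if \<gamma> = \<gamma>\<^sub>1 then w \<gamma> else 0))"
    using assms finite_G by (simp add: sum.distrib)
  also have "\<dots> \<le> (\<Sum>\<gamma>\<in>G. w \<gamma> * (if lf \<gamma>\<^sub>1 < \<gamma> \<and> \<gamma> < t then 1 else 0))"
    using b assms w_pos by (intro sum_mono) (auto intro: less_imp_le)
  also have "\<dots> = t - lf \<gamma>\<^sub>1"
    using assms b by (intro dist_indicator lf_in) auto
  finally show ?thesis by (simp add: w_def)
qed

text \<open>
  Here \<open>\<gamma>\<close> is the leftmost active threshold between \<open>s\<close> and \<open>t\<close>. Between \<open>s\<close> and \<open>\<gamma>\<close> each gap is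
  charged at most twice, since the backlog of \<open>\<gamma>\<close> can grow only where the transport term shrinks.
\<close>

lemma step_active:
  fixes f g :: "real \<Rightarrow> int"
  assumes st: "s \<in> S" "t \<in> S" "s < t"
    and f0: "\<And>x. x \<in> S \<Longrightarrow> 0 \<le> f x" and g0: "\<And>x. x \<in> S \<Longrightarrow> 0 \<le> g x"
    and f1: "1 \<le> f s" and g1: "1 \<le> g t"
    and ex: "\<exists>\<gamma>\<in>G. s < \<gamma> \<and> \<gamma> < t \<and> active f \<gamma>"
  shows "\<exists>\<gamma>\<in>G. lo \<gamma> \<le> s \<and> s < \<gamma> \<and> \<gamma> < t \<and> active f \<gamma> \<and>
     (t - s) + transport S G w (f(s := f s - 1)) (g(t := g t - 1)) +
      2 * detour S G lo hi w (f(s := f s - 1)) (g(t := g t - 1)) \<le>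
     transport S G w f g + 2 * detour S G lo hi w f g + (2 + 2 * \<rho>) * (t - \<gamma>)"
proof -
  let ?f = "f(s := f s - 1)" and ?g = "g(t := g t - 1)"
  let ?X = "{\<gamma>\<in>G. s < \<gamma> \<and> \<gamma> < t \<and> active f \<gamma>}"
  define v where "v = Min ?X"
  have "v \<in> ?X" unfolding v_def using ex finite_G by (intro Min_in) auto
  then have v: "v \<in> G" "s < v" "v < t" "active f v" by auto
  have v_min: "v \<le> \<gamma>" if "\<gamma> \<in> ?X" for \<gamma> using that finite_G by (simp add: v_def)
  note bv = lo_le_lf[OF v(1)] lf_less[OF v(1)] less_rt[OF v(1)] rt_le_hi[OF v(1)]
  \<comment> \<open>Otherwise the node separating \<open>s\<close> from \<open>lo v\<close> contains
    the node of \<open>v\<close>; it is then active too, and its threshold lies further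
    left.\<close>
  have lo_v: "lo v \<le> s"
  proof (rule ccontr)
    assume "\<not> lo v \<le> s"
    then obtain u where u: "u \<in> G" "lo u \<le> s" "s < u" "u < lo v" "lo v \<le> hi u"
      using split[OF st(1) lo_in[OF v(1)]] by force
    then have "hi v \<le> hi u" using laminar[OF u(1) v(1)] bv \<open>\<not> lo v \<le> s\<close> by linarith
    then have "active f u" using v(4) u(4) bv by (meson less_le_trans le_less_trans order_trans less_imp_le)
    then show False using v_min[of u] u bv v by auto
  qed
  have f_zero: "f x = 0" if x: "x \<in> S" "s < x" "x < v" for x
  proof (rule ccontr)
    assume "f x \<noteq> 0"
    obtain u where u: "u \<in> G" "s < u" "u < x" "x \<le> hi u"
      using split[OF st(1) x(1,2)] by blast
    then have "active f u" using \<open>f x \<noteq> 0\<close> f0[of x] x by force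
    then show False using v_min[of u] u x v by auto
  qed
  \<comment> \<open>Counts the thresholds between \<open>v\<close> and \<open>t\<close> whose left
    half contains \<open>\<delta>\<close>; the backlog of each may grow by one.\<close>
  define far where "far \<delta> = (\<Sum>\<gamma>\<in>G. if v < \<gamma> \<and> \<gamma> < t then (if lo \<gamma> < \<delta> \<and> \<delta> < \<gamma> then 1 else 0) else 0 :: int)" for \<delta>
  let ?c = "\<lambda>\<delta>. (if s < \<delta> \<and> \<delta> < t then 1 else 0) + (\<bar>ex ?f ?g \<delta>\<bar> - \<bar>ex f g \<delta>\<bar>) +
        2 * ((\<Sum>\<gamma>\<in>G. bl ?f ?g \<gamma> \<delta>) - (\<Sum>\<gamma>\<in>G. bl f g \<gamma> \<delta>))"
  have c: "?c \<delta> \<le> 2 * (if s < \<delta> \<and> \<delta> < t then 1 else 0) + 2 * (if lo v < \<delta> \<and> \<delta> < s then 1 else 0) + 2 * far \<delta>"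
    if \<delta>: "\<delta> \<in> G" for \<delta>
  proof -
    have "bl ?f ?g \<gamma> \<delta> - bl f g \<gamma> \<delta> \<le> (if v < \<gamma> \<and> \<gamma> < t then (if lo \<gamma> < \<delta> \<and> \<delta> < \<gamma> then 1 else 0) else 0)"
      if \<gamma>: "\<gamma> \<in> G - {v}" for \<gamma>
    proof (cases "s < \<gamma> \<and> \<gamma> < t \<and> active f \<gamma>")
      case True
      then have "v < \<gamma>" using v_min[of \<gamma>] \<gamma> by auto
      then show ?thesis using True bl_mono1[OF st(1,2), of f g \<gamma> \<delta>] by auto
    next
      case False
      then show ?thesis using bl_mono[OF _ st(1,2) False, of g \<delta>] \<gamma> by auto
    qed
    then have "(\<Sum>\<gamma>\<in>G - {v}. bl ?f ?g \<gamma> \<delta> - bl f g \<gamma> \<delta>) \<le>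
      (\<Sum>\<gamma>\<in>G - {v}. if v < \<gamma> \<and> \<gamma> < t then (if lo \<gamma> < \<delta> \<and> \<delta> < \<gamma> then 1 else 0) else 0)"
      by (rule sum_mono)
    also have "\<dots> = far \<delta>" unfolding far_def sum.remove[OF finite_G v(1)] by simp
    finally have 1: "(\<Sum>\<gamma>\<in>G. bl ?f ?g \<gamma> \<delta>) - (\<Sum>\<gamma>\<in>G. bl f g \<gamma> \<delta>) \<le> far \<delta> + (bl ?f ?g v \<delta> - bl f g v \<delta>)"
      unfolding sum.remove[OF finite_G v(1)] sum_subtractf by linarith
    have e: "ex ?f ?g \<delta> = ex f g \<delta> + (if s < \<delta> then 1 else 0) - (if t < \<delta> then 1 else 0)"
      by (rule excess_decr[OF finite_S st(1,2)])
    note m1 = bl_mono1[OF st(1,2), of f g v \<delta>]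
    \<comment> \<open>Between \<open>lo v\<close> and \<open>s\<close> only the backlog of
      \<open>v\<close> is charged. Between \<open>s\<close> and \<open>v\<close> a negative excess
      gives 1 - 1 + 2. Otherwise the charge is 1 + 1: the excess at \<open>v\<close> is already at
      least the optimum's capacity sum, so its growth cannot raise the backlog.\<close>
    have "(if s < \<delta> \<and> \<delta> < t then 1 else 0) + (\<bar>ex ?f ?g \<delta>\<bar> - \<bar>ex f g \<delta>\<bar>) + 2 * (bl ?f ?g v \<delta> - bl f g v \<delta>)
      \<le> 2 * (if s < \<delta> \<and> \<delta> < t then 1 else 0) + 2 * (if lo v < \<delta> \<and> \<delta> < s then 1 else 0)"
    proof -
      consider "\<delta> < s" | "t < \<delta>" | "v \<le> \<delta>" "\<delta> < t" | "s < \<delta>" "\<delta> < v" "ex f g \<delta> < 0" | "s < \<delta>" "\<delta> < v" "0 \<le> ex f g \<delta>"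
        using gap_not_server[OF \<delta>] st by (metis linorder_neqE not_le)
      then show ?thesis
      proof cases
        case 1
        then show ?thesis using e m1 v st by auto
      next
        case 2
        then have "bl ?f ?g v \<delta> = 0" "bl f g v \<delta> = 0" using v by (auto simp: backlog_def)
        then show ?thesis using e 2 st by auto
      next
        case 3
        then have "bl ?f ?g v \<delta> = 0" "bl f g v \<delta> = 0" using v by (auto simp: backlog_def)
        then show ?thesis using e 3 st v by auto
      next
        case 4
        then show ?thesis using e m1 v lo_v by auto
      next
        case 5
        let ?A = "{x\<in>S. lo v \<le> x \<and> x < \<delta>}" and ?B = "{x\<in>S. \<delta> < x \<and> x < v}"
        have "sum f ?B = 0" using f_zero 5 by (intro sum.neutral) auto
        then have n: "sum g ?B \<le> ex f g v"
          using excess_split[OF \<delta> 5(2), of f g] 5 by simp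
        have a': "sum ?f ?A \<le> sum f ?A"
          using finite_S by (simp add: sum_decr del: fun_upd_apply)
        have b': "sum ?g ?B \<le> sum g ?B"
          using finite_S by (simp add: sum_decr del: fun_upd_apply)
        have act: "lo v < \<delta> \<and> \<delta> < v \<and> active f v" using v lo_v 5 by auto
        have "bl ?f ?g v \<delta> \<le> max 0 (min (sum ?f ?A) (sum ?g ?B))"
          unfolding backlog_def by (auto simp del: fun_upd_apply)
        then have "bl ?f ?g v \<delta> \<le> bl f g v \<delta>"
          unfolding backlog_def[of _ _ _ f g] if_P[OF act] using a' b' n by linarith
        then show ?thesis using e 5 v by auto
      qed
    qed
    moreover have "a + b + 2 * i \<le> d + e + 2 * h" if "a + b + 2 * j \<le> d + e" "i \<le> h + j"
      for a b d e h i j :: int using that by linarith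
    ultimately show ?thesis using 1 by blast
  qed
  have "(\<Sum>\<delta>\<in>G. w \<delta> * real_of_int (?c \<delta>)) \<le>
     (\<Sum>\<delta>\<in>G. w \<delta> * real_of_int (2 * (if s < \<delta> \<and> \<delta> < t then 1 else 0) + 2 * (if lo v < \<delta> \<and> \<delta> < s then 1 else 0) + 2 * far \<delta>))"
    by (intro sum_mono mult_left_mono of_int_le_iff[THEN iffD2] c less_imp_le[OF w_pos])
  also have "\<dots> = (\<Sum>\<delta>\<in>G. 2 * (w \<delta> * (if s < \<delta> \<and> \<delta> < t then 1 else 0)) + 2 * (w \<delta> * (if lo v < \<delta> \<and> \<delta> < s then 1 else 0)) + 2 * (w \<delta> * real_of_int (far \<delta>)))"
    by (intro sum.cong refl) (simp add: algebra_simps)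
  also have "\<dots> = 2 * (t - s) + 2 * (s - lo v) + 2 * (\<Sum>\<delta>\<in>G. w \<delta> * real_of_int (far \<delta>))"
    using st lo_v lo_in[OF v(1)] by (simp only: sum.distrib sum_distrib_left[symmetric] dist_indicator less_imp_le)
  finally have 1: "(\<Sum>\<delta>\<in>G. w \<delta> * real_of_int (?c \<delta>)) \<le> 2 * (t - lo v) + 2 * (\<Sum>\<delta>\<in>G. w \<delta> * real_of_int (far \<delta>))"
    by simp
  have "(\<Sum>\<delta>\<in>G. w \<delta> * real_of_int (far \<delta>)) =
     (\<Sum>\<delta>\<in>G. \<Sum>\<gamma>\<in>G. if v < \<gamma> \<and> \<gamma> < t then w \<delta> * (if lo \<gamma> < \<delta> \<and> \<delta> < \<gamma> then 1 else 0) else 0)"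
    unfolding far_def of_int_sum sum_distrib_left by (intro sum.cong refl) auto
  \<comment> \<open>After the exchange of sums, each threshold between \<open>v\<close> and
    \<open>t\<close> is charged the width of its left half, which is at most
    \<open>(\<rho> - 1) * w \<gamma>\<close>.\<close>
  also have "\<dots> = (\<Sum>\<gamma>\<in>G. \<Sum>\<delta>\<in>G. if v < \<gamma> \<and> \<gamma> < t then w \<delta> * (if lo \<gamma> < \<delta> \<and> \<delta> < \<gamma> then 1 else 0) else 0)"
    by (rule sum.swap)
  also have "\<dots> \<le> (\<Sum>\<gamma>\<in>G. (\<rho> - 1) * (if v < \<gamma> \<and> \<gamma> < t then w \<gamma> else 0))"
  proof (rule sum_mono)
    fix \<gamma> assume "\<gamma> \<in> G"
    have "(\<Sum>\<delta>\<in>G. w \<delta> * (if lo \<gamma> < \<delta> \<and> \<delta> < \<gamma> then 1 else 0)) \<le> (\<rho> - 1) * w \<gamma>"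
      using width_left_of_gap[OF \<open>\<gamma> \<in> G\<close>] ratio[OF \<open>\<gamma> \<in> G\<close>] rt_le_hi[OF \<open>\<gamma> \<in> G\<close>]
      by (simp add: algebra_simps w_def)
    then show "(\<Sum>\<delta>\<in>G. if v < \<gamma> \<and> \<gamma> < t then w \<delta> * (if lo \<gamma> < \<delta> \<and> \<delta> < \<gamma> then 1 else 0) else 0)
      \<le> (\<rho> - 1) * (if v < \<gamma> \<and> \<gamma> < t then w \<gamma> else 0)"
      by (cases "v < \<gamma> \<and> \<gamma> < t") (simp_all only: if_True if_False simp_thms mult_zero_right sum.neutral_const order_refl)
  qed
  also have "\<dots> \<le> (\<rho> - 1) * (t - rt v)"
    unfolding sum_distrib_left[symmetric]
    using width_right_of_gap[OF v(1) st(2) v(3)] rho_ge_1 by (intro mult_left_mono) auto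
  finally have 2: "(\<Sum>\<delta>\<in>G. w \<delta> * real_of_int (far \<delta>)) \<le> (\<rho> - 1) * (t - rt v)" .
  have "2 * (t - lo v) + 2 * ((\<rho> - 1) * (t - rt v)) = 2 * (rt v - lo v) + 2 * \<rho> * (t - rt v)"
    by (simp add: algebra_simps)
  \<comment> \<open>The position of the threshold enters here: by \<open>ratio_rt\<close> the
    stretch from \<open>lo v\<close> to \<open>rt v\<close> is paid by the distance from
    \<open>v\<close> to \<open>rt v\<close>.\<close>
  also have "\<dots> \<le> 2 * ((1 + \<rho>) * (rt v - v)) + (2 + 2 * \<rho>) * (t - rt v)"
    using ratio_rt[OF v(1)] adjacent[OF v(1) st(2)] bv v(3)
    by (intro add_mono mult_left_mono mult_right_mono) auto
  also have "\<dots> = (2 + 2 * \<rho>) * (t - v)" by (simp add: algebra_simps)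
  finally have "(\<Sum>\<delta>\<in>G. w \<delta> * real_of_int (?c \<delta>)) \<le> (2 + 2 * \<rho>) * (t - v)" using 1 2 by linarith
  then show ?thesis
    using potential_step[OF st(1,2) less_imp_le[OF st(3)], of ?f ?g f g] v lo_v by (intro bexI[of _ v]) auto
qed

text \<open>\<open>pick\<close> is the threshold rule of PTCP. Where the potential alone does not
  pay, it gives \<open>r \<le> \<gamma> < t\<close> for the leftmost active threshold, and the
  optimum's own cost, at least \<open>t - \<gamma>\<close>, covers the rest.\<close>

lemma serve_right:
  fixes f g :: "real \<Rightarrow> int"
  assumes st: "s \<in> S" "t \<in> S" "s < t"
    and f0: "\<And>x. x \<in> S \<Longrightarrow> 0 \<le> f x" and g0: "\<And>x. x \<in> S \<Longrightarrow> 0 \<le> g x"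
    and f1: "1 \<le> f s" and g1: "1 \<le> g t" and tot: "sum f S = sum g S"
    and pick: "\<And>\<gamma>. \<gamma> \<in> G \<Longrightarrow> lo \<gamma> \<le> s \<Longrightarrow> s < \<gamma> \<Longrightarrow> active f \<gamma> \<Longrightarrow> r \<le> \<gamma>"
  shows "\<bar>r - s\<bar> + transport S G w (f(s := f s - 1)) (g(t := g t - 1)) +
      2 * detour S G lo hi w (f(s := f s - 1)) (g(t := g t - 1)) \<le>
    transport S G w f g + 2 * detour S G lo hi w f g + (1 + 2 * \<rho>) * \<bar>r - t\<bar>"
proof (cases "\<exists>\<gamma>\<in>G. s < \<gamma> \<and> \<gamma> < t \<and> active f \<gamma>")
  case False
  then have "(t - s) + transport S G w (f(s := f s - 1)) (g(t := g t - 1)) +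
      2 * detour S G lo hi w (f(s := f s - 1)) (g(t := g t - 1)) \<le>
    transport S G w f g + 2 * detour S G lo hi w f g"
    by (intro step_inactive) (use assms in auto)
  moreover define K where "K = (1 + 2 * \<rho>) * \<bar>r - t\<bar>"
  have "1 * \<bar>r - t\<bar> \<le> K"
    unfolding K_def using rho_ge_1 by (intro mult_right_mono) auto
  moreover have "\<bar>r - s\<bar> \<le> (t - s) + \<bar>r - t\<bar>" using st by linarith
  moreover have "a + b + d \<le> e + h + k" if "i + b + d \<le> e + h" "1 * j \<le> k" "a \<le> i + j"
    for a b d e h i j k :: real using that by linarith
  ultimately show ?thesis unfolding K_def[symmetric] by blast
next
  case True
  obtain \<gamma> where \<gamma>: "\<gamma> \<in> G" "lo \<gamma> \<le> s" "s < \<gamma>" "\<gamma> < t" "active f \<gamma>"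
    and le: "(t - s) + transport S G w (f(s := f s - 1)) (g(t := g t - 1)) +
      2 * detour S G lo hi w (f(s := f s - 1)) (g(t := g t - 1)) \<le>
     transport S G w f g + 2 * detour S G lo hi w f g + (2 + 2 * \<rho>) * (t - \<gamma>)"
    using step_active[of s t f g, OF st f0 g0 f1 g1 True] by blast
  have r: "r \<le> \<gamma>" using pick \<gamma> by blast
  \<comment> \<open>If \<open>r\<close> lies left of \<open>s\<close>, both costs contain the
    stretch from \<open>r\<close> to \<open>s\<close>; what remains is the case of a request at
    \<open>m\<close>.\<close>
  define m where "m = max r s"
  have m: "m \<le> \<gamma>" "r \<le> m" using r \<gamma> by (auto simp: m_def)
  have "(2 + 2 * \<rho>) * (t - \<gamma>) \<le> (2 + 2 * \<rho>) * (t - m)"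
    using rho_ge_1 m by (intro mult_left_mono) auto
  moreover have "1 * (m - r) \<le> (1 + 2 * \<rho>) * (m - r)"
    using rho_ge_1 m by (intro mult_right_mono) auto
  moreover have "(2 + 2 * \<rho>) * (t - m) + (1 + 2 * \<rho>) * (m - r) =
      (1 + 2 * \<rho>) * (t - r) + (t - m)"
    by (simp add: algebra_simps)
  moreover have r_t: "\<bar>r - t\<bar> = t - r" and r_s: "\<bar>r - s\<bar> = m - s + (m - r)" using r \<gamma> by (auto simp: m_def)
  ultimately have "\<bar>r - s\<bar> + (2 + 2 * \<rho>) * (t - \<gamma>) \<le> (1 + 2 * \<rho>) * \<bar>r - t\<bar> + (t - s)"
    unfolding r_t r_s by (smt (verit))
  moreover have "a + b + d \<le> e + h + k" if "i + b + d \<le> e + h + j" "a + j \<le> k + i"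
    for a b d e h i j k :: real using that by linarith
  ultimately show ?thesis using le by blast
qed

section \<open>Reflection, and the amortised bound for a whole run\<close>

lemma mirror:
  "gap_hierarchy (uminus ` S) (uminus ` G) (\<lambda>\<gamma>. - hi (- \<gamma>)) (\<lambda>\<gamma>. - lo (- \<gamma>))
     (\<lambda>\<gamma>. - rt (- \<gamma>)) (\<lambda>\<gamma>. - lf (- \<gamma>)) \<rho>"
proof (unfold_locales, goal_cases)
  case (9 \<gamma>) then show ?case using less_rt by force
next
  case (10 \<gamma>) then show ?case using lf_less by force
next
  case (11 \<gamma> t) then show ?case using adjacent by force
next
  case (12 s t)
  have "{\<gamma> \<in> uminus ` G. s < \<gamma> \<and> \<gamma> < t} = uminus ` {\<gamma> \<in> G. - t < \<gamma> \<and> \<gamma> < - s}" by force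
  then have "(\<Sum>\<gamma>\<in>{\<gamma> \<in> uminus ` G. s < \<gamma> \<and> \<gamma> < t}. - lf (- \<gamma>) - - rt (- \<gamma>)) =
     (\<Sum>\<gamma>\<in>{\<gamma> \<in> G. - t < \<gamma> \<and> \<gamma> < - s}. rt \<gamma> - lf \<gamma>)"
    by (simp add: sum.reindex)
  then show ?case using dist[of "- t" "- s"] 12 by force
next
  case (13 s t)
  then obtain \<gamma> where "\<gamma> \<in> G" "lo \<gamma> \<le> - t" "- t < \<gamma>" "\<gamma> < - s" "- s \<le> hi \<gamma>"
    using split[of "- t" "- s"] by force
  then show ?case by (intro bexI[of _ "- \<gamma>"]) auto
next
  case (14 u v)
  then show ?case using laminar[of "- v" "- u"] by force
next
  case (15 \<gamma>)
  then show ?case using ratio_lf by force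
next
  case (16 \<gamma>)
  then show ?case using ratio_rt by force
next
  case (17 \<gamma>)
  then show ?case using ratio by force
qed (use finite_S finite_G lo_in hi_in lf_in rt_in lo_le_lf rt_le_hi rho_ge_1 in auto)

text \<open>Requests bound to the left are treated by reflecting the instance in the origin.\<close>

definition potential :: "(real \<Rightarrow> int) \<Rightarrow> (real \<Rightarrow> int) \<Rightarrow> real" where
  "potential f g = transport S G w f g + 2 * detour S G lo hi w f g +
     2 * detour (uminus ` S) (uminus ` G) (\<lambda>\<gamma>. - hi (- \<gamma>)) (\<lambda>\<gamma>. - lo (- \<gamma>)) (\<lambda>\<gamma>. w (- \<gamma>))
       (\<lambda>x. f (- x)) (\<lambda>x. g (- x))"

text \<open>With equal totals, the excess counted from the right is the negative of that counted
  from the left. Hence both directions share the one transport term in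
  \<open>potential\<close>.\<close>

lemma transport_mirror:
  assumes "sum f S = sum g S"
  shows "transport (uminus ` S) (uminus ` G) (\<lambda>\<gamma>. w (- \<gamma>)) (\<lambda>x. f (- x)) (\<lambda>x. g (- x)) = transport S G w f g"
proof -
  have "excess (uminus ` S) (\<lambda>x. f (- x)) (\<lambda>x. g (- x)) (- \<gamma>) = - ex f g \<gamma>" if "\<gamma> \<in> G" for \<gamma>
  proof -
    have "{t \<in> uminus ` S. t < - \<gamma>} = uminus ` {t\<in>S. \<gamma> < t}" by force
    then have 1: "excess (uminus ` S) (\<lambda>x. f (- x)) (\<lambda>x. g (- x)) (- \<gamma>) = (\<Sum>t\<in>{t\<in>S. \<gamma> < t}. g t - f t)"
      by (simp add: excess_def sum.reindex)
    have "S = {t\<in>S. t < \<gamma>} \<union> {t\<in>S. \<gamma> < t}" using gap_not_server[OF that] by force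
    then have "(\<Sum>t\<in>S. g t - f t) = (\<Sum>t\<in>{t\<in>S. t < \<gamma>} \<union> {t\<in>S. \<gamma> < t}. g t - f t)" by simp
    also have "\<dots> = (\<Sum>t\<in>{t\<in>S. t < \<gamma>}. g t - f t) + (\<Sum>t\<in>{t\<in>S. \<gamma> < t}. g t - f t)"
      using finite_S by (intro sum.union_disjoint) auto
    finally show ?thesis using 1 assms by (simp add: excess_def sum_subtractf)
  qed
  then show ?thesis by (simp add: transport_def sum.reindex)
qed

lemma potential_nonneg: "0 \<le> potential f g"
proof -
  have "0 \<le> transport S G w f g"
    unfolding transport_def using w_pos by (intro sum_nonneg mult_nonneg_nonneg) (auto intro: less_imp_le)
  moreover have d: "0 \<le> detour S' G' l h w' f' g'" if "\<And>\<gamma>. \<gamma> \<in> G' \<Longrightarrow> 0 < w' \<gamma>" for S' G' l h w' f' g'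
    unfolding detour_def using that
    by (intro sum_nonneg mult_nonneg_nonneg of_int_0_le_iff[THEN iffD2]) (auto simp: backlog_def intro: less_imp_le)
  moreover have "0 \<le> detour S G lo hi w f g"
    "0 \<le> detour (uminus ` S) (uminus ` G) (\<lambda>\<gamma>. - hi (- \<gamma>)) (\<lambda>\<gamma>. - lo (- \<gamma>)) (\<lambda>\<gamma>. w (- \<gamma>))
       (\<lambda>x. f (- x)) (\<lambda>x. g (- x))" by (rule d; use w_pos in auto)+
  ultimately show ?thesis unfolding potential_def by simp
qed

lemma potential_refl: "potential f f = 0"
proof -
  have "excess T h h \<gamma> = 0" for T h \<gamma> by (simp add: excess_def)
  moreover from this have "backlog T l u h h \<gamma> \<delta> = 0" for T l u h \<gamma> \<delta> by (simp add: backlog_def)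
  ultimately show ?thesis by (simp add: potential_def transport_def detour_def)
qed

text \<open>A step can raise only the detour term of its own direction. \<open>serve_right\<close>
  or its mirror image bounds that term together with the transport term, and
  \<open>detour_mono\<close> bounds the other one.\<close>

lemma potential_serve:
  fixes f g :: "real \<Rightarrow> int"
  assumes st: "s \<in> S" "t \<in> S"
    and f0: "\<And>x. x \<in> S \<Longrightarrow> 0 \<le> f x" and g0: "\<And>x. x \<in> S \<Longrightarrow> 0 \<le> g x"
    and f1: "1 \<le> f s" and g1: "1 \<le> g t" and tot: "sum f S = sum g S"
    and pick_lf: "\<And>\<gamma>. \<gamma> \<in> G \<Longrightarrow> lo \<gamma> \<le> s \<Longrightarrow> s < \<gamma> \<Longrightarrow> \<exists>x\<in>S. \<gamma> < x \<and> x \<le> hi \<gamma> \<and> 0 < f x \<Longrightarrow> r \<le> \<gamma>"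
    and pick_rt: "\<And>\<gamma>. \<gamma> \<in> G \<Longrightarrow> \<gamma> < s \<Longrightarrow> s \<le> hi \<gamma> \<Longrightarrow> \<exists>x\<in>S. lo \<gamma> \<le> x \<and> x < \<gamma> \<and> 0 < f x \<Longrightarrow> \<gamma> \<le> r"
  shows "\<bar>r - s\<bar> + potential (f(s := f s - 1)) (g(t := g t - 1)) \<le> potential f g + (1 + 2 * \<rho>) * \<bar>r - t\<bar>"
proof -
  interpret m: gap_hierarchy "uminus ` S" "uminus ` G" "\<lambda>\<gamma>. - hi (- \<gamma>)" "\<lambda>\<gamma>. - lo (- \<gamma>)"
     "\<lambda>\<gamma>. - rt (- \<gamma>)" "\<lambda>\<gamma>. - lf (- \<gamma>)" \<rho> by (rule mirror)
  let ?f = "f(s := f s - 1)" and ?g = "g(t := g t - 1)"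
  let ?f' = "\<lambda>x. f (- x)" and ?g' = "\<lambda>x. g (- x)"
  have w': "m.w = (\<lambda>\<gamma>. w (- \<gamma>))" by (simp add: fun_eq_iff m.w_def w_def)
  have upd: "(\<lambda>x. ?f (- x)) = ?f'(- s := ?f' (- s) - 1)" "(\<lambda>x. ?g (- x)) = ?g'(- t := ?g' (- t) - 1)"
    by (auto simp: fun_eq_iff)
  have tot': "sum ?f S = sum ?g S"
    using tot st finite_S by (simp add: sum_decr del: fun_upd_apply)
  have left: "detour S G lo hi w ?f ?g \<le> detour S G lo hi w f g" if "t \<le> s"
    using that st by (intro detour_mono)
  have right: "detour (uminus ` S) (uminus ` G) (\<lambda>\<gamma>. - hi (- \<gamma>)) (\<lambda>\<gamma>. - lo (- \<gamma>)) (\<lambda>\<gamma>. w (- \<gamma>))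
       (\<lambda>x. ?f (- x)) (\<lambda>x. ?g (- x)) \<le>
     detour (uminus ` S) (uminus ` G) (\<lambda>\<gamma>. - hi (- \<gamma>)) (\<lambda>\<gamma>. - lo (- \<gamma>)) (\<lambda>\<gamma>. w (- \<gamma>)) ?f' ?g'" if "s \<le> t"
    unfolding upd w'[symmetric] using that st by (intro m.detour_mono) auto
  consider "s < t" | "s = t" | "t < s" by linarith
  then show ?thesis
  proof cases
    case 1
    have "\<bar>r - s\<bar> + transport S G w ?f ?g + 2 * detour S G lo hi w ?f ?g \<le>
        transport S G w f g + 2 * detour S G lo hi w f g + (1 + 2 * \<rho>) * \<bar>r - t\<bar>"
      by (rule serve_right) (use assms 1 in auto)
    then show ?thesis using right 1 unfolding potential_def by linarith
  next
    case 2
    have "ex ?f ?g \<gamma> = ex f g \<gamma>" for \<gamma> using excess_decr[OF finite_S st] 2 by simp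
    then have "transport S G w ?f ?g = transport S G w f g" by (simp add: transport_def)
    moreover have "1 * \<bar>r - s\<bar> \<le> (1 + 2 * \<rho>) * \<bar>r - s\<bar>"
      using rho_ge_1 by (intro mult_right_mono) auto
    ultimately show ?thesis using left right 2 unfolding potential_def by simp
  next
    case 3
    have "\<bar>- r - - s\<bar> + transport (uminus ` S) (uminus ` G) m.w (?f'(- s := ?f' (- s) - 1)) (?g'(- t := ?g' (- t) - 1)) +
        2 * detour (uminus ` S) (uminus ` G) (\<lambda>\<gamma>. - hi (- \<gamma>)) (\<lambda>\<gamma>. - lo (- \<gamma>)) m.w
          (?f'(- s := ?f' (- s) - 1)) (?g'(- t := ?g' (- t) - 1)) \<le>
        transport (uminus ` S) (uminus ` G) m.w ?f' ?g' +
        2 * detour (uminus ` S) (uminus ` G) (\<lambda>\<gamma>. - hi (- \<gamma>)) (\<lambda>\<gamma>. - lo (- \<gamma>)) m.w ?f' ?g' +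
        (1 + 2 * \<rho>) * \<bar>- r - - t\<bar>"
    proof (rule m.serve_right)
      show "sum ?f' (uminus ` S) = sum ?g' (uminus ` S)" using tot by (simp add: sum.reindex)
    next
      fix \<gamma> assume "\<gamma> \<in> uminus ` G" "- hi (- \<gamma>) \<le> - s" "- s < \<gamma>"
        "\<exists>t\<in>uminus ` S. \<gamma> < t \<and> t \<le> - lo (- \<gamma>) \<and> 0 < f (- t)"
      then show "- r \<le> \<gamma>" using pick_rt[of "- \<gamma>"] by force
    qed (use st 3 f0 g0 f1 g1 in auto)
    then have "\<bar>r - s\<bar> + transport S G w ?f ?g +
        2 * detour (uminus ` S) (uminus ` G) (\<lambda>\<gamma>. - hi (- \<gamma>)) (\<lambda>\<gamma>. - lo (- \<gamma>)) (\<lambda>\<gamma>. w (- \<gamma>))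
          (\<lambda>x. ?f (- x)) (\<lambda>x. ?g (- x)) \<le> transport S G w f g +
        2 * detour (uminus ` S) (uminus ` G) (\<lambda>\<gamma>. - hi (- \<gamma>)) (\<lambda>\<gamma>. - lo (- \<gamma>)) (\<lambda>\<gamma>. w (- \<gamma>)) ?f' ?g' +
        (1 + 2 * \<rho>) * \<bar>r - t\<bar>"
      unfolding upd[symmetric] w' transport_mirror[OF tot] transport_mirror[OF tot']
      by (simp add: abs_minus_commute del: fun_upd_apply)
    then show ?thesis using left 3 unfolding potential_def by linarith
  qed
qed

text \<open>The steps telescope, as the potential starts at 0 and is never negative. The comparison
  is with every feasible matching, because a prefix of an optimal matching need not be
  optimal.\<close>

lemma online_cost_bound:
  assumes A: "online_algorithm S c A"
    and pick_lf: "\<And>\<sigma> r s \<gamma>. length \<sigma> < sum c S \<Longrightarrow> A (\<sigma> @ [r]) = A \<sigma> @ [s] \<Longrightarrow> \<gamma> \<in> G \<Longrightarrow> lo \<gamma> \<le> s \<Longrightarrow> s < \<gamma> \<Longrightarrow>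
        \<exists>x\<in>free_servers S c (A \<sigma>). \<gamma> < x \<and> x \<le> hi \<gamma> \<Longrightarrow> r \<le> \<gamma>"
    and pick_rt: "\<And>\<sigma> r s \<gamma>. length \<sigma> < sum c S \<Longrightarrow> A (\<sigma> @ [r]) = A \<sigma> @ [s] \<Longrightarrow> \<gamma> \<in> G \<Longrightarrow> \<gamma> < s \<Longrightarrow> s \<le> hi \<gamma> \<Longrightarrow>
        \<exists>x\<in>free_servers S c (A \<sigma>). lo \<gamma> \<le> x \<and> x < \<gamma> \<Longrightarrow> \<gamma> \<le> r"
    and "feasible_matching S c \<sigma> ms" "length \<sigma> \<le> sum c S"
  shows "matching_cost \<sigma> (A \<sigma>) \<le> (1 + 2 * \<rho>) * matching_cost \<sigma> ms"
proof -
  let ?c = "\<lambda>ms x. int (c x) - int (count_list ms x)"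
  have "matching_cost \<sigma> (A \<sigma>) + potential (?c (A \<sigma>)) (?c ms) \<le> (1 + 2 * \<rho>) * matching_cost \<sigma> ms"
    using assms(4,5)
  proof (induction \<sigma> arbitrary: ms rule: rev_induct)
    case Nil
    then show ?case
      using A by (simp add: online_algorithm_def feasible_matching_def matching_cost_def potential_refl)
  next
    case (snoc r \<sigma>)
    from snoc.prems obtain ms' t where ms: "ms = ms' @ [t]"
      by (cases ms rule: rev_cases) (auto simp: feasible_matching_def)
    have len: "length \<sigma> < sum c S" using snoc.prems by simp
    then obtain s where s: "s \<in> free_servers S c (A \<sigma>)" "A (\<sigma> @ [r]) = A \<sigma> @ [s]"
      using A unfolding online_algorithm_def by blast
    have feas: "feasible_matching S c \<sigma> (A \<sigma>)"
      using online_algorithm_feasible[OF A] len by simp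
    have cap: "count_list ms' x + (if x = t then 1 else 0) \<le> c x" if "x \<in> S" for x
      using snoc.prems(1) that by (auto simp: ms feasible_matching_def)
    have cap': "count_list ms' x \<le> c x" if "x \<in> S" for x using cap[OF that] by simp
    have feas': "feasible_matching S c \<sigma> ms'"
      using snoc.prems(1) cap' by (auto simp: ms feasible_matching_def)
    have t: "t \<in> S" using snoc.prems(1) by (auto simp: ms feasible_matching_def)
    have sS: "s \<in> S" and sc: "count_list (A \<sigma>) s < c s" using s by (auto simp: free_servers_def)
    have tot: "sum (?c xs) S = int (sum c S) - int (length \<sigma>)" if "feasible_matching S c \<sigma> xs" for xs
      using length_eq_sum_count_list[OF finite_S, of xs] that
      by (simp add: sum_subtractf feasible_matching_def)
    have free: "x \<in> free_servers S c (A \<sigma>)" if "x \<in> S" "0 < ?c (A \<sigma>) x" for x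
      using that by (simp add: free_servers_def)
    have "\<bar>r - s\<bar> + potential ((?c (A \<sigma>))(s := ?c (A \<sigma>) s - 1)) ((?c ms')(t := ?c ms' t - 1)) \<le>
        potential (?c (A \<sigma>)) (?c ms') + (1 + 2 * \<rho>) * \<bar>r - t\<bar>"
    proof (rule potential_serve)
      show "sum (?c (A \<sigma>)) S = sum (?c ms') S" using tot feas feas' by simp
      show "1 \<le> ?c ms' t" using cap[OF t] by simp
      show "r \<le> \<gamma>" if "\<gamma> \<in> G" "lo \<gamma> \<le> s" "s < \<gamma>"
        "\<exists>x\<in>S. \<gamma> < x \<and> x \<le> hi \<gamma> \<and> 0 < ?c (A \<sigma>) x" for \<gamma>
        using pick_lf[OF len s(2) that(1-3)] that(4) free by blast
      show "\<gamma> \<le> r" if "\<gamma> \<in> G" "\<gamma> < s" "s \<le> hi \<gamma>"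
        "\<exists>x\<in>S. lo \<gamma> \<le> x \<and> x < \<gamma> \<and> 0 < ?c (A \<sigma>) x" for \<gamma>
        using pick_rt[OF len s(2) that(1-3)] that(4) free by blast
    qed (use sS t sc cap' feas in \<open>auto simp: feasible_matching_def\<close>)
    moreover have "(?c (A \<sigma>))(s := ?c (A \<sigma>) s - 1) = ?c (A (\<sigma> @ [r]))" "(?c ms')(t := ?c ms' t - 1) = ?c ms"
      by (auto simp: s ms fun_eq_iff)
    moreover have "matching_cost (\<sigma> @ [r]) (xs @ [x]) = matching_cost \<sigma> xs + \<bar>r - x\<bar>"
      if "feasible_matching S c \<sigma> xs" for xs x
      using that by (auto simp: matching_cost_def feasible_matching_def nth_append intro!: sum.cong)
    moreover have "matching_cost \<sigma> (A \<sigma>) + potential (?c (A \<sigma>)) (?c ms') \<le> (1 + 2 * \<rho>) * matching_cost \<sigma> ms'"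
      using snoc.IH feas' len by simp
    ultimately show ?case using feas feas' by (simp add: ms s(2) distrib_left)
  qed
  then show ?thesis using potential_nonneg[of "?c (A \<sigma>)" "?c ms"] by linarith
qed

end

section \<open>The tree of PTCP\<close>

text \<open>The threshold divides the gap in the proportion of \<open>\<Delta>\<^sub>2 + D\<close>
  to \<open>\<Delta>\<^sub>1 + D\<close>. Both quotients in question therefore equal
  \<open>K / D\<close>, which is at most \<open>1 + \<rho>\<close>.\<close>

lemma threshold_ratio:
  fixes \<Delta>\<^sub>1 \<Delta>\<^sub>2 D \<rho> :: real
  assumes "0 \<le> \<Delta>\<^sub>1" "0 \<le> \<Delta>\<^sub>2" "0 < D" and \<rho>: "\<Delta>\<^sub>1 + \<Delta>\<^sub>2 + D \<le> \<rho> * D"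
  defines "x \<equiv> (\<Delta>\<^sub>2 + D) / (\<Delta>\<^sub>1 + \<Delta>\<^sub>2 + 2 * D) * D"
  shows "0 < x" "x < D" "\<Delta>\<^sub>2 + D \<le> (1 + \<rho>) * x" "\<Delta>\<^sub>1 + D \<le> (1 + \<rho>) * (D - x)"
proof -
  define K where "K = \<Delta>\<^sub>1 + \<Delta>\<^sub>2 + 2 * D"
  have K: "0 < K" "K \<le> (1 + \<rho>) * D" using assms by (simp_all add: K_def algebra_simps)
  have x: "x = (\<Delta>\<^sub>2 + D) * (D / K)" and y: "D - x = (\<Delta>\<^sub>1 + D) * (D / K)"
    using K(1) by (simp_all add: x_def K_def field_simps)
  have DK: "0 < D / K" "1 \<le> (1 + \<rho>) * (D / K)" using K assms(3) by (simp_all add: field_simps)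
  show "0 < x" unfolding x using DK assms by (intro mult_pos_pos) auto
  have "0 < D - x" unfolding y using DK assms by (intro mult_pos_pos) auto
  then show "x < D" by simp
  have *: "a \<le> (1 + \<rho>) * (a * (D / K))" if "0 \<le> a" for a
    using mult_left_mono[OF DK(2) that] by (simp only: ac_simps mult_1_right)
  show "\<Delta>\<^sub>2 + D \<le> (1 + \<rho>) * x" unfolding x using assms by (intro *) auto
  show "\<Delta>\<^sub>1 + D \<le> (1 + \<rho>) * (D - x)" unfolding y using assms by (intro *) auto
qed

text \<open>Stated for all pairs of end points, so that it passes to the halves in which the
  recursion continues and yields \<open>ratio\<close> at every node.\<close>

definition has_wide_gaps :: "real \<Rightarrow> real set \<Rightarrow> bool" where
  "has_wide_gaps \<rho> T \<longleftrightarrow> (\<forall>a\<in>T. \<forall>b\<in>T. a < b \<longrightarrow>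
     (\<exists>u\<in>T. \<exists>v\<in>T. a \<le> u \<and> u < v \<and> v \<le> b \<and> (\<forall>t\<in>T. t \<le> u \<or> v \<le> t) \<and> b - a \<le> \<rho> * (v - u)))"

text \<open>The two threshold conditions of \<open>potential_serve\<close>, for every set of free
  servers because the recursion restricts \<open>F\<close> to a half.\<close>

definition ptcp_respects ::
    "(real set \<Rightarrow> real) \<Rightarrow> real set \<Rightarrow> real set \<Rightarrow> (real \<Rightarrow> real) \<Rightarrow> (real \<Rightarrow> real) \<Rightarrow> bool" where
  "ptcp_respects p T G lo hi \<longleftrightarrow> (\<forall>r F \<gamma>. F \<subseteq> T \<longrightarrow> F \<noteq> {} \<longrightarrow> \<gamma> \<in> G \<longrightarrow>
     (lo \<gamma> \<le> ptcp p T r F \<and> ptcp p T r F < \<gamma> \<and> (\<exists>x\<in>F. \<gamma> < x \<and> x \<le> hi \<gamma>) \<longrightarrow> r \<le> \<gamma>) \<and>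
     (\<gamma> < ptcp p T r F \<and> ptcp p T r F \<le> hi \<gamma> \<and> (\<exists>x\<in>F. lo \<gamma> \<le> x \<and> x < \<gamma>) \<longrightarrow> \<gamma> \<le> r))"

text \<open>\<open>\<theta>\<close> becomes the root. All of \<open>G1\<close> lies left of
  \<open>u\<close> and all of \<open>G2\<close> right of \<open>v\<close>, so \<open>glue\<close>
  recognises the subtree of a threshold by comparing it with \<open>\<theta>\<close>.\<close>

lemma gap_hierarchy_join:
  fixes lo1 lo2 hi1 hi2 lf1 lf2 rt1 rt2 :: "real \<Rightarrow> real" and \<theta> a b u v :: real
  assumes 1: "gap_hierarchy T1 G1 lo1 hi1 lf1 rt1 \<rho>" and 2: "gap_hierarchy T2 G2 lo2 hi2 lf2 rt2 \<rho>"
    and T1: "a \<in> T1" "u \<in> T1" "\<And>t. t \<in> T1 \<Longrightarrow> a \<le> t \<and> t \<le> u"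
    and T2: "v \<in> T2" "b \<in> T2" "\<And>t. t \<in> T2 \<Longrightarrow> v \<le> t \<and> t \<le> b"
    and \<theta>: "u < \<theta>" "\<theta> < v"
    and ratios: "v - a \<le> (1 + \<rho>) * (v - \<theta>)" "b - u \<le> (1 + \<rho>) * (\<theta> - u)" "b - a \<le> \<rho> * (v - u)"
  defines "glue \<equiv> \<lambda>(x :: real) h1 h2 \<gamma>. if \<gamma> = \<theta> then x else if \<gamma> < \<theta> then h1 \<gamma> else h2 \<gamma>"
  shows "gap_hierarchy (T1 \<union> T2) (insert \<theta> (G1 \<union> G2)) (glue a lo1 lo2) (glue b hi1 hi2)
    (glue u lf1 lf2) (glue v rt1 rt2) \<rho>"
proof -
  interpret h1: gap_hierarchy T1 G1 lo1 hi1 lf1 rt1 \<rho> by (rule 1)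
  interpret h2: gap_hierarchy T2 G2 lo2 hi2 lf2 rt2 \<rho> by (rule 2)
  have in1: "a \<le> lo1 \<gamma> \<and> lo1 \<gamma> \<le> lf1 \<gamma> \<and> lf1 \<gamma> < \<gamma> \<and> \<gamma> < rt1 \<gamma> \<and> rt1 \<gamma> \<le> hi1 \<gamma> \<and> hi1 \<gamma> \<le> u" if "\<gamma> \<in> G1" for \<gamma>
    using that h1.lo_le_lf h1.lf_less h1.less_rt h1.rt_le_hi T1(3)[OF h1.hi_in] T1(3)[OF h1.lo_in] by auto
  have in2: "v \<le> lo2 \<gamma> \<and> lo2 \<gamma> \<le> lf2 \<gamma> \<and> lf2 \<gamma> < \<gamma> \<and> \<gamma> < rt2 \<gamma> \<and> rt2 \<gamma> \<le> hi2 \<gamma> \<and> hi2 \<gamma> \<le> b" if "\<gamma> \<in> G2" for \<gamma>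
    using that h2.lo_le_lf h2.lf_less h2.less_rt h2.rt_le_hi T2(3)[OF h2.hi_in] T2(3)[OF h2.lo_in] by auto
  have gt: "glue x h1 h2 \<theta> = x" for x h1 h2 by (simp add: glue_def)
  have g1: "glue x h1 h2 \<gamma> = h1 \<gamma>" "\<gamma> < u" if "\<gamma> \<in> G1" for x h1 h2 \<gamma>
    using in1[OF that] \<theta> by (auto simp: glue_def)
  have g2: "glue x h1 h2 \<gamma> = h2 \<gamma>" "v < \<gamma>" if "\<gamma> \<in> G2" for x h1 h2 \<gamma>
    using in2[OF that] \<theta> by (auto simp: glue_def)
  note g = gt g1(1) g2(1)
  have "a \<le> u" "v \<le> b" using T1 T2 by auto
  let ?G = "insert \<theta> (G1 \<union> G2)"
  have dist1: "t - s = (\<Sum>\<gamma>\<in>{\<gamma>\<in>?G. s < \<gamma> \<and> \<gamma> < t}. glue v rt1 rt2 \<gamma> - glue u lf1 lf2 \<gamma>)"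
    if "s \<in> T1" "t \<in> T1" "s \<le> t" for s t
  proof -
    have "{\<gamma>\<in>?G. s < \<gamma> \<and> \<gamma> < t} = {\<gamma>\<in>G1. s < \<gamma> \<and> \<gamma> < t}"
      using that T1(3)[of t] \<theta> g2(2) by force
    then show ?thesis using h1.dist[OF that] by (simp add: g)
  qed
  have dist2: "t - s = (\<Sum>\<gamma>\<in>{\<gamma>\<in>?G. s < \<gamma> \<and> \<gamma> < t}. glue v rt1 rt2 \<gamma> - glue u lf1 lf2 \<gamma>)"
    if "s \<in> T2" "t \<in> T2" "s \<le> t" for s t
  proof -
    have "{\<gamma>\<in>?G. s < \<gamma> \<and> \<gamma> < t} = {\<gamma>\<in>G2. s < \<gamma> \<and> \<gamma> < t}"
      using that T2(3)[of s] \<theta> g1(2) by force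
    then show ?thesis using h2.dist[OF that] by (simp add: g)
  qed
  have dist12: "t - s = (\<Sum>\<gamma>\<in>{\<gamma>\<in>?G. s < \<gamma> \<and> \<gamma> < t}. glue v rt1 rt2 \<gamma> - glue u lf1 lf2 \<gamma>)"
    if "s \<in> T1" "t \<in> T2" for s t
  proof -
    let ?L = "{\<gamma>\<in>?G. s < \<gamma> \<and> \<gamma> < u}" and ?R = "{\<gamma>\<in>?G. v < \<gamma> \<and> \<gamma> < t}"
    have "{\<gamma>\<in>?G. s < \<gamma> \<and> \<gamma> < t} = insert \<theta> (?L \<union> ?R)"
      using T1(3)[OF that(1)] T2(3)[OF that(2)] \<theta> g1(2) g2(2) by force
    moreover have "(\<Sum>\<gamma>\<in>insert \<theta> (?L \<union> ?R). glue v rt1 rt2 \<gamma> - glue u lf1 lf2 \<gamma>) = (v - u) +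
       ((\<Sum>\<gamma>\<in>?L. glue v rt1 rt2 \<gamma> - glue u lf1 lf2 \<gamma>) + (\<Sum>\<gamma>\<in>?R. glue v rt1 rt2 \<gamma> - glue u lf1 lf2 \<gamma>))"
      using h1.finite_G h2.finite_G \<theta>
      by (subst sum.insert) (auto simp: gt intro!: sum.union_disjoint)
    moreover have "s \<le> u" "v \<le> t" using T1(3)[OF that(1)] T2(3)[OF that(2)] by auto
    ultimately have "(\<Sum>\<gamma>\<in>{\<gamma>\<in>?G. s < \<gamma> \<and> \<gamma> < t}. glue v rt1 rt2 \<gamma> - glue u lf1 lf2 \<gamma>) =
        (v - u) + ((u - s) + (t - v))"
      using dist1[OF that(1) T1(2)] dist2[OF T2(1) that(2)] by (simp only:)
    then show ?thesis by simp
  qed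
  show ?thesis
  proof (unfold_locales, goal_cases)
    case 1
    then show ?case using h1.finite_S h2.finite_S by blast
  next
    case 2
    then show ?case using h1.finite_G h2.finite_G by blast
  next
    case (3 \<gamma>)
    then show ?case using h1.lo_in h2.lo_in T1 by (auto simp: g)
  next
    case (4 \<gamma>)
    then show ?case using h1.hi_in h2.hi_in T2 by (auto simp: g)
  next
    case (5 \<gamma>)
    then show ?case using h1.lf_in h2.lf_in T1 by (auto simp: g)
  next
    case (6 \<gamma>)
    then show ?case using h1.rt_in h2.rt_in T2 by (auto simp: g)
  next
    case (7 \<gamma>)
    then show ?case using in1[of \<gamma>] in2[of \<gamma>] \<open>a \<le> u\<close> by (auto simp: g)
  next
    case (8 \<gamma>)
    then show ?case using in1[of \<gamma>] in2[of \<gamma>] \<open>v \<le> b\<close> by (auto simp: g)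
  next
    case (9 \<gamma>)
    then show ?case using in1[of \<gamma>] in2[of \<gamma>] \<theta> by (auto simp: g)
  next
    case (10 \<gamma>)
    then show ?case using in1[of \<gamma>] in2[of \<gamma>] \<theta> by (auto simp: g)
  next
    case (11 \<gamma> t)
    consider "t \<in> T1" | "t \<in> T2" using 11 by blast
    note t = this
    consider "\<gamma> = \<theta>" | "\<gamma> \<in> G1" | "\<gamma> \<in> G2" using 11 by blast
    then show ?case
    proof cases
      case 1
      from t show ?thesis unfolding 1 gt using T1(3)[of t] T2(3)[of t] by cases auto
    next
      case 2
      have "rt1 \<gamma> \<le> u" using in1[OF 2] by linarith
      with t show ?thesis unfolding g1(1)[OF 2] using h1.adjacent[OF 2] T2(3)[of t] \<theta> by cases auto
    next
      case 3
      have "v \<le> lf2 \<gamma>" using in2[OF 3] by linarith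
      with t show ?thesis unfolding g2(1)[OF 3] using h2.adjacent[OF 3] T1(3)[of t] \<theta> by cases auto
    qed
  next
    case (12 s t)
    consider "s \<in> T1" "t \<in> T1" | "s \<in> T2" "t \<in> T2" | "s \<in> T1" "t \<in> T2"
      using 12 T1(3)[of t] T2(3)[of s] \<theta> by force
    then show ?case using dist1 dist2 dist12 12(3) by cases blast+
  next
    case (13 s t)
    consider "s \<in> T1" "t \<in> T1" | "s \<in> T2" "t \<in> T2" | "s \<in> T1" "t \<in> T2"
      using 13 T1(3)[of t] T2(3)[of s] \<theta> by force
    then show ?case
    proof cases
      case 1
      then obtain \<gamma> where "\<gamma> \<in> G1" "lo1 \<gamma> \<le> s" "s < \<gamma>" "\<gamma> < t" "t \<le> hi1 \<gamma>" using h1.split 13(3) by blast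
      then show ?thesis by (intro bexI[of _ \<gamma>]) (simp_all add: g)
    next
      case 2
      then obtain \<gamma> where "\<gamma> \<in> G2" "lo2 \<gamma> \<le> s" "s < \<gamma>" "\<gamma> < t" "t \<le> hi2 \<gamma>" using h2.split 13(3) by blast
      then show ?thesis by (intro bexI[of _ \<gamma>]) (simp_all add: g)
    next
      case 3
      then show ?thesis using T1(3)[of s] T2(3)[of t] \<theta> by (intro bexI[of _ \<theta>]) (auto simp: gt)
    qed
  next
    case (14 x y)
    consider "x \<in> G1" "y \<in> G1" | "x \<in> G1" "y = \<theta>" | "x \<in> G1" "y \<in> G2" | "x = \<theta>" "y \<in> G2" | "x \<in> G2" "y \<in> G2"
      using 14 g1(2) g2(2) \<theta> by force
    then show ?case
    proof cases
      case 1
      then show ?thesis unfolding g1(1)[OF 1(1)] g1(1)[OF 1(2)] by (intro h1.laminar 14)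
    next
      case 2
      then show ?thesis unfolding g1(1)[OF 2(1)] 2(2) gt using in1[OF 2(1)] \<theta> by auto
    next
      case 3
      then show ?thesis unfolding g1(1)[OF 3(1)] g2(1)[OF 3(2)] using in1[OF 3(1)] in2[OF 3(2)] \<theta> by auto
    next
      case 4
      then show ?thesis unfolding g2(1)[OF 4(2)] 4(1) gt using in2[OF 4(2)] \<theta> by auto
    next
      case 5
      then show ?thesis unfolding g2(1)[OF 5(1)] g2(1)[OF 5(2)] by (intro h2.laminar 14)
    qed
  next
    case (15 \<gamma>)
    then show ?case using h1.ratio_rt h2.ratio_rt ratios by (auto simp: g)
  next
    case (16 \<gamma>)
    then show ?case using h1.ratio_lf h2.ratio_lf ratios by (auto simp: g)
  next
    case (17 \<gamma>)
    then show ?case using h1.ratio h2.ratio ratios by (auto simp: g)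
  next
    case 18
    show ?case by (rule h1.rho_ge_1)
  qed
qed

text \<open>Induction along the recursion of PTCP: both halves consist of consecutive servers and
  inherit the gap condition, and their trees are joined at the threshold used for
  \<open>T\<close>.\<close>

lemma ptcp_hierarchy:
  assumes p: "gap_choice p" and \<rho>: "1 \<le> \<rho>"
  shows "finite T \<Longrightarrow> T \<noteq> {} \<Longrightarrow> has_wide_gaps \<rho> T \<Longrightarrow>
    \<exists>G lo hi lf rt. gap_hierarchy T G lo hi lf rt \<rho> \<and> ptcp_respects p T G lo hi"
proof (induction "card T" arbitrary: T rule: less_induct)
  case less
  show ?case
  proof (cases "is_singleton T")
    case True
    then obtain x where T: "T = {x}" by (auto simp: is_singleton_def)
    have "gap_hierarchy T {} id id id id \<rho>"
      using \<rho> by unfold_locales (auto simp: T)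
    then show ?thesis by (intro exI[of _ "{}"] exI[of _ id]) (simp add: ptcp_respects_def)
  next
    case False
    have "card T \<noteq> 1" using False by (simp add: is_singleton_altdef)
    then have "2 \<le> card T" using less.prems card_gt_0_iff[of T] by linarith
    define u where "u = p T"
    define T1 where "T1 = {s \<in> T. s \<le> u}"
    define T2 where "T2 = {s \<in> T. u < s}"
    define a where "a = Min T"
    define b where "b = Max T"
    define v where "v = next_server T u"
    have w: "widest_gap_at T u" using p less.prems(1) \<open>2 \<le> card T\<close> by (auto simp: gap_choice_def u_def)
    have u: "u \<in> T" "u < b" using w by (auto simp: widest_gap_at_def b_def)
    have ab: "a \<in> T" "b \<in> T" "\<And>t. t \<in> T \<Longrightarrow> a \<le> t \<and> t \<le> b"
      using less.prems by (auto simp: a_def b_def)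
    have v_eq: "v = Min T2" by (simp add: v_def next_server_def T2_def)
    have fin: "finite T1" "finite T2" and ne: "T1 \<noteq> {}" "T2 \<noteq> {}"
      using less.prems u ab by (auto simp: T1_def T2_def)
    have v: "v \<in> T2" "\<And>t. t \<in> T2 \<Longrightarrow> v \<le> t"
      using fin ne by (auto simp: v_eq)
    have T12: "T = T1 \<union> T2" by (auto simp: T1_def T2_def)
    have "u \<notin> T2" "b \<notin> T1" using u by (auto simp: T1_def T2_def)
    then have "T1 \<subset> T" "T2 \<subset> T" using u(1) ab(2) unfolding T12 by blast+
    then have card: "card T1 < card T" "card T2 < card T"
      using less.prems(1) by (auto intro: psubset_card_mono)
    have wide: "has_wide_gaps \<rho> T1" "has_wide_gaps \<rho> T2"
    proof -
      have "has_wide_gaps \<rho> T'" if T': "T' \<subseteq> T" "\<And>x y z. x \<in> T' \<Longrightarrow> z \<in> T' \<Longrightarrow> y \<in> T \<Longrightarrow> x \<le> y \<Longrightarrow> y \<le> z \<Longrightarrow> y \<in> T'" for T'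
        unfolding has_wide_gaps_def
      proof (intro ballI impI)
        fix x z assume xz: "x \<in> T'" "z \<in> T'" "x < z"
        then obtain y y' where y: "y \<in> T" "y' \<in> T" "x \<le> y" "y < y'" "y' \<le> z" "\<forall>t\<in>T. t \<le> y \<or> y' \<le> t" "z - x \<le> \<rho> * (y' - y)"
          using less.prems(3)[unfolded has_wide_gaps_def, rule_format, OF subsetD[OF T'(1)] subsetD[OF T'(1)]]
          by blast
        then have "y \<in> T'" "y' \<in> T'" using T'(2)[OF xz(1,2)] by auto
        then show "\<exists>u\<in>T'. \<exists>v\<in>T'. x \<le> u \<and> u < v \<and> v \<le> z \<and> (\<forall>t\<in>T'. t \<le> u \<or> v \<le> t) \<and> z - x \<le> \<rho> * (v - u)"
          using y T'(1) by blast
      qed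
      from this[of T1] this[of T2] show "has_wide_gaps \<rho> T1" "has_wide_gaps \<rho> T2"
        by (simp_all add: T1_def T2_def)
    qed
    obtain G1 lo1 hi1 lf1 rt1 where 1: "gap_hierarchy T1 G1 lo1 hi1 lf1 rt1 \<rho>" "ptcp_respects p T1 G1 lo1 hi1"
      using less.hyps[OF card(1) fin(1) ne(1) wide(1)] by blast
    obtain G2 lo2 hi2 lf2 rt2 where 2: "gap_hierarchy T2 G2 lo2 hi2 lf2 rt2 \<rho>" "ptcp_respects p T2 G2 lo2 hi2"
      using less.hyps[OF card(2) fin(2) ne(2) wide(2)] by blast
    have "u < v" using v by (simp add: T2_def)
    \<comment> \<open>The gap supplied by \<open>has_wide_gaps\<close> is no wider than the widest
      one, which PTCP cuts.\<close>
    have "b - a \<le> \<rho> * (v - u)"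
    proof -
      have "a < b" using ab(3)[OF u(1)] u(2) by simp
      then obtain y z where yz: "y \<in> T" "z \<in> T" "y < z" "\<forall>t\<in>T. t \<le> y \<or> z \<le> t" "b - a \<le> \<rho> * (z - y)"
        using less.prems(3)[unfolded has_wide_gaps_def, rule_format, OF ab(1,2)] by blast
      have "z \<le> next_server T y"
        unfolding next_server_def using yz less.prems(1) by (subst Min_ge_iff) auto
      moreover have "next_server T y - y \<le> v - u"
        using w yz ab(3)[OF yz(2)] unfolding widest_gap_at_def v_def b_def by auto
      ultimately have "\<rho> * (z - y) \<le> \<rho> * (v - u)" using \<rho> by (intro mult_left_mono) auto
      then show ?thesis using yz by linarith
    qed
    define \<theta> where "\<theta> = u + ((b - v) + (v - u)) / ((u - a) + (b - v) + 2 * (v - u)) * (v - u)"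
    have th: "u < \<theta>" "\<theta> < v" "v - a \<le> (1 + \<rho>) * (v - \<theta>)" "b - u \<le> (1 + \<rho>) * (\<theta> - u)"
      using threshold_ratio[of "u - a" "b - v" "v - u" \<rho>] \<open>u < v\<close> \<open>b - a \<le> \<rho> * (v - u)\<close>
        ab(3)[OF u(1)] ab(3)[of v] v(1) by (auto simp: \<theta>_def T2_def algebra_simps)
    let ?glue = "\<lambda>(x :: real) h1 h2 \<gamma>. if \<gamma> = \<theta> then x else if \<gamma> < \<theta> then h1 \<gamma> else h2 \<gamma>"
    let ?G = "insert \<theta> (G1 \<union> G2)"
    have h: "gap_hierarchy (T1 \<union> T2) ?G (?glue a lo1 lo2) (?glue b hi1 hi2) (?glue u lf1 lf2) (?glue v rt1 rt2) \<rho>"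
    proof (rule gap_hierarchy_join[OF 1(1) 2(1)])
      show "a \<in> T1" "u \<in> T1" "b \<in> T2" using ab u by (auto simp: T1_def T2_def)
    qed (use v ab th \<open>b - a \<le> \<rho> * (v - u)\<close> in \<open>auto simp: T1_def T2_def\<close>)
    interpret h1: gap_hierarchy T1 G1 lo1 hi1 lf1 rt1 \<rho> by (rule 1)
    interpret h2: gap_hierarchy T2 G2 lo2 hi2 lf2 rt2 \<rho> by (rule 2)
    have in1: "\<gamma> < \<theta>" "lo1 \<gamma> \<in> T1" "hi1 \<gamma> \<in> T1" if "\<gamma> \<in> G1" for \<gamma>
      using that h1.less_rt[of \<gamma>] h1.rt_in[of \<gamma>] h1.lo_in h1.hi_in th by (auto simp: T1_def)
    have in2: "\<theta> < \<gamma>" "lo2 \<gamma> \<in> T2" "hi2 \<gamma> \<in> T2" if "\<gamma> \<in> G2" for \<gamma>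
      using that h2.lf_less[of \<gamma>] v(2)[OF h2.lf_in[of \<gamma>]] h2.lo_in h2.hi_in th by auto
    have "ptcp_respects p T ?G (?glue a lo1 lo2) (?glue b hi1 hi2)"
      unfolding ptcp_respects_def
    proof (intro allI impI)
      fix r F \<gamma> assume F: "F \<subseteq> T" "F \<noteq> {}" and \<gamma>: "\<gamma> \<in> ?G"
      let ?s = "ptcp p T r F"
      let ?P = "\<lambda>s. (?glue a lo1 lo2 \<gamma> \<le> s \<and> s < \<gamma> \<and> (\<exists>x\<in>F. \<gamma> < x \<and> x \<le> ?glue b hi1 hi2 \<gamma>) \<longrightarrow> r \<le> \<gamma>) \<and>
         (\<gamma> < s \<and> s \<le> ?glue b hi1 hi2 \<gamma> \<and> (\<exists>x\<in>F. ?glue a lo1 lo2 \<gamma> \<le> x \<and> x < \<gamma>) \<longrightarrow> \<gamma> \<le> r)"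
      show "?P ?s"
      proof (cases "is_singleton F")
        case True
        \<comment> \<open>A single free server cannot lie on both sides of \<open>\<gamma>\<close>,
          so both implications are vacuous.\<close>
        then show ?thesis by (subst (1 2 3 4) ptcp.simps) (auto simp: is_singleton_def)
      next
        case False
        have s: "?s = (if r \<le> \<theta> \<and> F \<inter> T1 \<noteq> {} \<or> F \<inter> T2 = {} then ptcp p T1 r (F \<inter> T1) else ptcp p T2 r (F \<inter> T2))"
          using False unfolding ptcp.simps[of p T r F] Let_def
          by (simp add: \<theta>_def a_def b_def v_def u_def T1_def T2_def)
        show ?thesis
        proof (cases "r \<le> \<theta> \<and> F \<inter> T1 \<noteq> {} \<or> F \<inter> T2 = {}")
          case True
          then have ne1: "F \<inter> T1 \<noteq> {}" using F T12 by blast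
          define s where "s = ptcp p T1 r (F \<inter> T1)"
          have sT: "s \<in> T1" using ptcp_in_free[OF p fin(1) _ ne1] by (auto simp: s_def)
          have s_eq: "?s = s" using s True by (simp add: s_def)
          have R: "\<gamma> \<in> G1 \<Longrightarrow> lo1 \<gamma> \<le> s \<Longrightarrow> s < \<gamma> \<Longrightarrow> \<exists>x\<in>F \<inter> T1. \<gamma> < x \<and> x \<le> hi1 \<gamma> \<Longrightarrow> r \<le> \<gamma>"
            "\<gamma> \<in> G1 \<Longrightarrow> \<gamma> < s \<Longrightarrow> s \<le> hi1 \<gamma> \<Longrightarrow> \<exists>x\<in>F \<inter> T1. lo1 \<gamma> \<le> x \<and> x < \<gamma> \<Longrightarrow> \<gamma> \<le> r"
            using 1(2) ne1 unfolding ptcp_respects_def s_def by blast+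
          consider "\<gamma> = \<theta>" | "\<gamma> \<in> G1" | "\<gamma> \<in> G2" using \<gamma> by blast
          then show ?thesis unfolding s_eq
          proof cases
            case 1
            \<comment> \<open>A free server right of \<open>\<theta>\<close> lies in
              \<open>T2\<close>, so the left branch was taken because of the position of
              \<open>r\<close>.\<close>
            have "r \<le> \<theta>" if "x \<in> F" "\<theta> < x" for x
              using that True F th by (force simp: T1_def T2_def)
            then show "?P s" using 1 sT th by (auto simp: T1_def)
          next
            case 2
            have "x \<in> T1" if "x \<in> F" "x \<le> hi1 \<gamma> \<or> x < \<gamma>" for x
              using that F in1[OF 2] th h1.less_rt[OF 2] h1.rt_in[OF 2] by (auto simp: T1_def)
            then show "?P s" using R 2 in1[OF 2] by (simp only: less_imp_neq if_False if_True) blast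
          next
            case 3
            then show "?P s" using sT in2[OF 3] th by (auto simp: T1_def T2_def)
          qed
        next
          case False
          then have ne2: "F \<inter> T2 \<noteq> {}" by blast
          define s where "s = ptcp p T2 r (F \<inter> T2)"
          have sT: "s \<in> T2" using ptcp_in_free[OF p fin(2) _ ne2] by (auto simp: s_def)
          have s_eq: "?s = s" using s False by (simp add: s_def)
          have R: "\<gamma> \<in> G2 \<Longrightarrow> lo2 \<gamma> \<le> s \<Longrightarrow> s < \<gamma> \<Longrightarrow> \<exists>x\<in>F \<inter> T2. \<gamma> < x \<and> x \<le> hi2 \<gamma> \<Longrightarrow> r \<le> \<gamma>"
            "\<gamma> \<in> G2 \<Longrightarrow> \<gamma> < s \<Longrightarrow> s \<le> hi2 \<gamma> \<Longrightarrow> \<exists>x\<in>F \<inter> T2. lo2 \<gamma> \<le> x \<and> x < \<gamma> \<Longrightarrow> \<gamma> \<le> r"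
            using 2(2) ne2 unfolding ptcp_respects_def s_def by blast+
          consider "\<gamma> = \<theta>" | "\<gamma> \<in> G1" | "\<gamma> \<in> G2" using \<gamma> by blast
          then show ?thesis unfolding s_eq
          proof cases
            case 1
            have "\<theta> \<le> r" if "x \<in> F" "x < \<theta>" for x
            proof -
              have "x \<in> T1" using that F th v(2)[of x] by (force simp: T12)
              then show ?thesis using False that by auto
            qed
            then show "?P s" using 1 v(2)[OF sT] th by auto
          next
            case 2
            then show "?P s" using v(2)[OF sT] in1[OF 2] th by (auto simp: T1_def)
          next
            case 3
            have "x \<in> T2" if "x \<in> F" "lo2 \<gamma> \<le> x \<or> \<gamma> < x" for x
              using that F in2[OF 3] th by (auto simp: T2_def)
            then show "?P s" using R 3 in2[OF 3]
              by (simp only: less_imp_neq[THEN not_sym] less_not_sym if_False) blast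
          qed
        qed
      qed
    qed
    with h[folded T12] show ?thesis by (intro exI conjI)
  qed
qed

lemma ptcp_competitive:
  assumes "ofal_instance S c" "gap_choice p" "1 \<le> \<rho>" "has_wide_gaps \<rho> S" and \<beta>: "1 + 2 * \<rho> \<le> \<beta>"
  shows "competitive S c (ptcp_algorithm p S c) \<beta>"
proof -
  have S: "finite S" "S \<noteq> {}" using assms(1) by (auto simp: ofal_instance_def)
  let ?A = "ptcp_algorithm p S c"
  note A = ptcp_algorithm_online[OF assms(1,2)]
  obtain G lo hi lf rt where G: "gap_hierarchy S G lo hi lf rt \<rho>" "ptcp_respects p S G lo hi"
    using ptcp_hierarchy[OF assms(2,3) S assms(4)] by blast
  have bound: "matching_cost \<sigma> (?A \<sigma>) \<le> (1 + 2 * \<rho>) * matching_cost \<sigma> ms"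
    if feas: "feasible_matching S c \<sigma> ms" and len: "length \<sigma> \<le> sum c S" for \<sigma> ms
  proof (rule gap_hierarchy.online_cost_bound[OF G(1) A _ _ feas len])
    fix \<sigma> r s \<gamma> assume len: "length \<sigma> < sum c S" and step: "?A (\<sigma> @ [r]) = ?A \<sigma> @ [s]" and \<gamma>: "\<gamma> \<in> G"
    let ?F = "free_servers S c (?A \<sigma>)"
    have s: "s = ptcp p S r ?F" using step by (simp add: ptcp_algorithm_def)
    have F: "?F \<subseteq> S" by (auto simp: free_servers_def)
    have "feasible_matching S c \<sigma> (?A \<sigma>)" using online_algorithm_feasible[OF A] len by simp
    then have "?F \<noteq> {}" using free_servers_nonempty[OF S(1) _ len] by blast
    then have R: "(lo \<gamma> \<le> s \<and> s < \<gamma> \<and> (\<exists>x\<in>?F. \<gamma> < x \<and> x \<le> hi \<gamma>) \<longrightarrow> r \<le> \<gamma>) \<and>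
       (\<gamma> < s \<and> s \<le> hi \<gamma> \<and> (\<exists>x\<in>?F. lo \<gamma> \<le> x \<and> x < \<gamma>) \<longrightarrow> \<gamma> \<le> r)"
      using G(2) F \<gamma> unfolding ptcp_respects_def s by blast
    show "lo \<gamma> \<le> s \<Longrightarrow> s < \<gamma> \<Longrightarrow> \<exists>x\<in>?F. \<gamma> < x \<and> x \<le> hi \<gamma> \<Longrightarrow> r \<le> \<gamma>"
      and "\<gamma> < s \<Longrightarrow> s \<le> hi \<gamma> \<Longrightarrow> \<exists>x\<in>?F. lo \<gamma> \<le> x \<and> x < \<gamma> \<Longrightarrow> \<gamma> \<le> r"
      using R by blast+
  qed
  show ?thesis
    unfolding competitive_def
  proof (intro allI impI)
    fix \<sigma> :: "real list" assume len: "length \<sigma> \<le> sum c S"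
    let ?M = "{ms. feasible_matching S c \<sigma> ms}"
    have "finite ?M"
      by (rule finite_subset[OF _ finite_lists_length_eq[OF S(1), of "length \<sigma>"]])
        (auto simp: feasible_matching_def)
    moreover have "?M \<noteq> {}" using online_algorithm_feasible[OF A len] by blast
    ultimately have opt: "opt_cost S c \<sigma> \<in> matching_cost \<sigma> ` ?M"
      unfolding opt_cost_def by (intro Min_in) auto
    then have "0 \<le> opt_cost S c \<sigma>" by (auto simp: matching_cost_def intro: sum_nonneg)
    moreover have "matching_cost \<sigma> (?A \<sigma>) \<le> (1 + 2 * \<rho>) * opt_cost S c \<sigma>"
      using opt bound len by auto
    ultimately show "matching_cost \<sigma> (?A \<sigma>) \<le> \<beta> * opt_cost S c \<sigma>"
      using \<beta> by (meson mult_right_mono order_trans)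
  qed
qed

section \<open>The geometric instance\<close>

text \<open>The widest of at most \<open>card T - 1\<close> gaps is at least as wide as their
  average; the induction removes the leftmost gap.\<close>

lemma has_wide_gaps_card:
  assumes "finite T"
  shows "has_wide_gaps (real (card T) - 1) T"
  unfolding has_wide_gaps_def
proof (intro ballI impI)
  fix a b assume ab: "a \<in> T" "b \<in> T" "a < b"
  have "\<exists>u\<in>T. \<exists>v\<in>T. a \<le> u \<and> u < v \<and> v \<le> b \<and> (\<forall>t\<in>T. t \<le> u \<or> v \<le> t) \<and>
      b - a \<le> real (card {t\<in>T. a < t \<and> t \<le> b}) * (v - u)"
    using ab
  proof (induction "card {t\<in>T. a < t \<and> t \<le> b}" arbitrary: a)
    case 0
    then show ?case using assms by auto
  next
    case (Suc m)
    define d where "d = next_server T a"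
    have "d \<in> {t\<in>T. a < t}"
      unfolding d_def next_server_def using Suc.prems assms by (intro Min_in) auto
    moreover have d_le: "d \<le> t" if "t \<in> T" "a < t" for t
      unfolding d_def next_server_def using that assms by (intro Min_le) auto
    ultimately have d: "d \<in> T" "a < d" "d \<le> b" using Suc.prems by auto
    have eq: "{t\<in>T. a < t \<and> t \<le> b} = insert d {t\<in>T. d < t \<and> t \<le> b}"
      using d d_le by force
    then have "card {t\<in>T. a < t \<and> t \<le> b} = Suc (card {t\<in>T. d < t \<and> t \<le> b})"
      using assms by simp
    with Suc.hyps(2) have m: "m = card {t\<in>T. d < t \<and> t \<le> b}" and Suc_m: "card {t\<in>T. a < t \<and> t \<le> b} = Suc m"
      by simp_all
    have cons: "\<forall>t\<in>T. t \<le> a \<or> d \<le> t" using d_le by force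
    show ?case
    proof (cases "d = b")
      case True
      have "{t\<in>T. b < t \<and> t \<le> b} = {}" by auto
      then have "m = 0" using m True by (metis card.empty)
      then show ?thesis using True cons Suc.prems Suc_m by (intro bexI[of _ a] bexI[of _ b]) auto
    next
      case False
      then obtain u v where uv: "u \<in> T" "v \<in> T" "d \<le> u" "u < v" "v \<le> b" "\<forall>t\<in>T. t \<le> u \<or> v \<le> t"
        "b - d \<le> real m * (v - u)"
        using Suc.hyps(1)[OF m] d Suc.prems by (auto simp: m)
      show ?thesis
      proof (cases "d - a \<le> v - u")
        case True
        then have "b - a \<le> real (Suc m) * (v - u)" using uv by (simp add: algebra_simps)
        then show ?thesis unfolding Suc_m using uv d by (intro bexI[of _ u] bexI[of _ v]) auto
      next
        case False
        then have "real m * (v - u) \<le> real m * (d - a)" by (intro mult_left_mono) auto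
        then have "b - a \<le> real (Suc m) * (d - a)" using uv by (simp add: algebra_simps)
        then show ?thesis unfolding Suc_m using d cons Suc.prems by (intro bexI[of _ a] bexI[of _ d]) auto
      qed
    qed
  qed
  then obtain u v where uv: "u \<in> T" "v \<in> T" "a \<le> u" "u < v" "v \<le> b" "\<forall>t\<in>T. t \<le> u \<or> v \<le> t"
      "b - a \<le> real (card {t\<in>T. a < t \<and> t \<le> b}) * (v - u)" by blast
  have "card {t\<in>T. a < t \<and> t \<le> b} < card T" using ab assms by (intro psubset_card_mono) auto
  then have "real (card {t\<in>T. a < t \<and> t \<le> b}) * (v - u) \<le> (real (card T) - 1) * (v - u)"
    using uv by (intro mult_right_mono) auto
  then have "b - a \<le> (real (card T) - 1) * (v - u)" using uv by linarith
  with uv show "\<exists>u\<in>T. \<exists>v\<in>T. a \<le> u \<and> u < v \<and> v \<le> b \<and> (\<forall>t\<in>T. t \<le> u \<or> v \<le> t) \<and>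
      b - a \<le> (real (card T) - 1) * (v - u)"
    by blast
qed

lemma has_wide_gaps_mono:
  assumes "has_wide_gaps \<rho> T" "\<rho> \<le> \<rho>'"
  shows "has_wide_gaps \<rho>' T"
  unfolding has_wide_gaps_def
proof (intro ballI impI)
  fix a b assume "a \<in> T" "b \<in> T" "a < b"
  from assms(1)[unfolded has_wide_gaps_def, rule_format, OF this]
  obtain u v where uv: "u \<in> T" "v \<in> T" "a \<le> u" "u < v" "v \<le> b" "\<forall>t\<in>T. t \<le> u \<or> v \<le> t" "b - a \<le> \<rho> * (v - u)"
    by blast
  have "\<rho> * (v - u) \<le> \<rho>' * (v - u)"
    using assms(2) uv by (intro mult_right_mono) auto
  then have "b - a \<le> \<rho>' * (v - u)" using uv by linarith
  with uv show "\<exists>u\<in>T. \<exists>v\<in>T. a \<le> u \<and> u < v \<and> v \<le> b \<and> (\<forall>t\<in>T. t \<le> u \<or> v \<le> t) \<and> b - a \<le> \<rho>' * (v - u)"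
    by blast
qed

text \<open>The sum form of \<open>(1 - \<delta> ^ i) / (1 - \<delta>)\<close>, from which the
  increments \<open>\<delta> ^ i\<close> and monotonicity for every positive \<open>\<delta>\<close>
  can be read off.\<close>

definition geo :: "real \<Rightarrow> nat \<Rightarrow> real" where
  "geo \<delta> i = (\<Sum>j<i. \<delta> ^ j)"

text \<open>The servers in the order \<open>s\<^sub>k\<^sub>+\<^sub>1, s\<^sub>k, s\<^sub>k\<^sub>+\<^sub>2, s\<^sub>k\<^sub>-\<^sub>1, \<dots>\<close> in which the adversary makes
  the permutation algorithm use them.\<close>

definition zigzag :: "real \<Rightarrow> nat \<Rightarrow> real" where
  "zigzag \<delta> n = (if even n then geo \<delta> (Suc (n div 2)) else - geo \<delta> (Suc (n div 2)))"

lemma geo_closed: "\<delta> \<noteq> 1 \<Longrightarrow> geo \<delta> i = (1 - \<delta> ^ i) / (1 - \<delta>)"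
  unfolding geo_def by (subst geometric_sum) (auto simp: field_simps)

lemma geo_Suc [simp]: "geo \<delta> (Suc i) = geo \<delta> i + \<delta> ^ i"
  by (simp add: geo_def)

lemma geo_strict_mono: "0 < \<delta> \<Longrightarrow> strict_mono (geo \<delta>)"
  by (simp add: strict_mono_Suc_iff)

lemma geo_ge_1: "0 < \<delta> \<Longrightarrow> 1 \<le> i \<Longrightarrow> 1 \<le> geo \<delta> i"
  using strict_mono_less_eq[OF geo_strict_mono, of \<delta> 1 i] by (simp add: geo_def)

lemma in_zigzag_iff:
  "t \<in> zigzag \<delta> ` {..<2 * k} \<longleftrightarrow> (\<exists>i\<in>{1..k}. t = geo \<delta> i \<or> t = - geo \<delta> i)"
proof
  assume "t \<in> zigzag \<delta> ` {..<2 * k}"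
  then obtain n where "n < 2 * k" "t = zigzag \<delta> n" by auto
  then show "\<exists>i\<in>{1..k}. t = geo \<delta> i \<or> t = - geo \<delta> i"
    unfolding zigzag_def by (intro bexI[of _ "Suc (n div 2)"]) auto
next
  assume "\<exists>i\<in>{1..k}. t = geo \<delta> i \<or> t = - geo \<delta> i"
  then obtain i where i: "i \<in> {1..k}" "t = geo \<delta> i \<or> t = - geo \<delta> i" by blast
  then obtain j where "i = Suc j" by (cases i) auto
  then have "t = zigzag \<delta> (2 * j) \<or> t = zigzag \<delta> (2 * j + 1)" using i by (auto simp: zigzag_def)
  then show "t \<in> zigzag \<delta> ` {..<2 * k}" using i \<open>i = Suc j\<close> by auto
qed

text \<open>On one side of the origin the gaps from the innermost one outwards add up to at most
  \<open>\<delta> ^ i / (1 - \<delta>)\<close>, where \<open>\<delta> ^ i\<close> is the innermost.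
  A range across the origin contains the central gap of width 2 and extends at most
  \<open>1 / (1 - \<delta>)\<close> to either side.\<close>

lemma zigzag_wide_gaps:
  assumes "0 < \<delta>" "\<delta> < 1"
  shows "has_wide_gaps (1 / (1 - \<delta>)) (zigzag \<delta> ` {..<2 * k})"
proof -
  let ?S = "zigzag \<delta> ` {..<2 * k}"
  note mono = strict_mono_less[OF geo_strict_mono[OF assms(1)]] strict_mono_less_eq[OF geo_strict_mono[OF assms(1)]]
  note ge1 = geo_ge_1[OF assms(1)]
  have bound: "geo \<delta> j - geo \<delta> i \<le> 1 / (1 - \<delta>) * (geo \<delta> (Suc i) - geo \<delta> i)" for i j
  proof -
    have "geo \<delta> j - geo \<delta> i = (\<delta> ^ i - \<delta> ^ j) / (1 - \<delta>)"
      using assms by (simp add: geo_closed diff_divide_distrib[symmetric])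
    also have "\<dots> \<le> \<delta> ^ i / (1 - \<delta>)"
      using assms by (intro divide_right_mono) auto
    finally show ?thesis by simp
  qed
  have geo_le: "geo \<delta> i \<le> 1 / (1 - \<delta>)" for i
    using assms by (simp add: geo_closed field_simps)
  have cons: "t \<le> geo \<delta> i \<or> geo \<delta> (Suc i) \<le> t" "t \<le> - geo \<delta> (Suc i) \<or> - geo \<delta> i \<le> t"
    if t: "t \<in> ?S" and i: "1 \<le> i" for t i
  proof -
    obtain j where j: "j \<in> {1..k}" "t = geo \<delta> j \<or> t = - geo \<delta> j" using t in_zigzag_iff by blast
    have "geo \<delta> j \<le> geo \<delta> i \<or> geo \<delta> (Suc i) \<le> geo \<delta> j"
      unfolding mono by linarith
    then show "t \<le> geo \<delta> i \<or> geo \<delta> (Suc i) \<le> t" "t \<le> - geo \<delta> (Suc i) \<or> - geo \<delta> i \<le> t"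
      using j ge1[of j] ge1[of i] i by auto
  qed
  show ?thesis unfolding has_wide_gaps_def
  proof (intro ballI impI)
    fix a b assume ab: "a \<in> ?S" "b \<in> ?S" "a < b"
    obtain i j where i: "i \<in> {1..k}" "a = geo \<delta> i \<or> a = - geo \<delta> i" and j: "j \<in> {1..k}" "b = geo \<delta> j \<or> b = - geo \<delta> j"
      using ab in_zigzag_iff by blast
    have pos: "1 \<le> geo \<delta> i" "1 \<le> geo \<delta> j" using i j ge1 by auto
    have mem: "geo \<delta> n \<in> ?S" "- geo \<delta> n \<in> ?S" if "1 \<le> n" "n \<le> k" for n
      using that in_zigzag_iff by auto
    consider "a = geo \<delta> i" "b = geo \<delta> j" | "a = - geo \<delta> i" "b = geo \<delta> j" | "a = - geo \<delta> i" "b = - geo \<delta> j"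
      using i j ab pos by force
    then show "\<exists>u\<in>?S. \<exists>v\<in>?S. a \<le> u \<and> u < v \<and> v \<le> b \<and> (\<forall>t\<in>?S. t \<le> u \<or> v \<le> t) \<and> b - a \<le> 1 / (1 - \<delta>) * (v - u)"
    proof cases
      case 1
      then have "i < j" using ab mono by simp
      then have "geo \<delta> (Suc i) \<le> geo \<delta> j" unfolding mono by simp
      then show ?thesis using 1 i j \<open>i < j\<close> cons(1)[of _ i] mem[of i] mem[of "Suc i"] bound[of j i] assms
        by (intro bexI[of _ "geo \<delta> i"] bexI[of _ "geo \<delta> (Suc i)"]) auto
    next
      case 2
      have g1: "geo \<delta> 1 = 1" by (simp add: geo_def)
      have "t \<le> - 1 \<or> 1 \<le> t" if t: "t \<in> ?S" for t
      proof -
        obtain i where "i \<in> {1..k}" "t = geo \<delta> i \<or> t = - geo \<delta> i" using t in_zigzag_iff by blast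
        then show ?thesis using ge1[of i] by auto
      qed
      then show ?thesis using 2 mem[of 1] i pos geo_le[of i] geo_le[of j] unfolding g1
        by (intro bexI[of _ "- 1"] bexI[of _ 1]) auto
    next
      case 3
      then have "j < i" using ab mono by simp
      then have "geo \<delta> (Suc j) \<le> geo \<delta> i" unfolding mono by simp
      then show ?thesis using 3 i j \<open>j < i\<close> cons(2)[of _ j] mem[of j] mem[of "Suc j"] bound[of i j] assms
        by (intro bexI[of _ "- geo \<delta> (Suc j)"] bexI[of _ "- geo \<delta> j"]) auto
    qed
  qed
qed

section \<open>The adversary against the permutation algorithm\<close>

lemma matching_cost_ge_sum_diff:
  assumes "length ms = length \<sigma>"
  shows "\<bar>sum_list ms - sum_list \<sigma>\<bar> \<le> matching_cost \<sigma> ms"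
proof -
  have "sum_list ms - sum_list \<sigma> = (\<Sum>i<length \<sigma>. ms ! i - \<sigma> ! i)"
    using assms by (simp add: sum_list_sum_nth sum_subtractf atLeast0LessThan)
  also have "\<bar>\<dots>\<bar> \<le> (\<Sum>i<length \<sigma>. \<bar>ms ! i - \<sigma> ! i\<bar>)" by (rule sum_abs)
  finally show ?thesis by (simp add: matching_cost_def abs_minus_commute)
qed

lemma matching_cost_append:
  assumes "length ms = length \<sigma>" "length ms' = length \<sigma>'"
  shows "matching_cost (\<sigma> @ \<sigma>') (ms @ ms') = matching_cost \<sigma> ms + matching_cost \<sigma>' ms'"
proof -
  have *: "matching_cost \<sigma> ms = sum_list (map2 (\<lambda>r m. \<bar>r - m\<bar>) \<sigma> ms)" if "length ms = length \<sigma>" for \<sigma> ms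
    using that by (simp add: matching_cost_def sum_list_sum_nth atLeast0LessThan)
  show ?thesis using assms by (simp add: *)
qed

lemma zigzag_dist:
  assumes "0 < \<delta>" "0 \<le> \<eta>" "\<eta> \<le> 1"
  shows "\<bar>zigzag \<delta> n - \<eta>\<bar> = geo \<delta> (Suc (n div 2)) + (if even n then - \<eta> else \<eta>)"
  using geo_ge_1[OF assms(1), of "Suc (n div 2)"] assms(2,3) by (auto simp: zigzag_def simp del: geo_Suc)

text \<open>The offset \<open>\<delta> ^ k / 2\<close> puts every right server before its mirror
  image. Twice the offset is \<open>\<delta> ^ k\<close>, less than any gap
  \<open>\<delta> ^ i\<close> with \<open>i < k\<close>, so the mirror image still comes before the
  next right server.\<close>

lemma zigzag_dist_less:
  assumes "0 < \<delta>" "\<delta> < 1" "m < n" "n < 2 * k"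
  shows "\<bar>zigzag \<delta> m - \<delta> ^ k / 2\<bar> < \<bar>zigzag \<delta> n - \<delta> ^ k / 2\<bar>"
  using assms(3,4)
proof (induction n)
  case (Suc n)
  have \<eta>: "0 < \<delta> ^ k / 2" "\<delta> ^ k / 2 \<le> 1" using assms power_le_one[of \<delta> k] by auto
  note dist = zigzag_dist[OF assms(1) less_imp_le[OF \<eta>(1)] \<eta>(2)]
  have "\<bar>zigzag \<delta> n - \<delta> ^ k / 2\<bar> < \<bar>zigzag \<delta> (Suc n) - \<delta> ^ k / 2\<bar>"
  proof (cases "even n")
    case True
    then show ?thesis unfolding dist using \<eta> by simp
  next
    case False
    then have "Suc (n div 2) < k" using Suc.prems by presburger
    then have "\<delta> ^ k < \<delta> ^ Suc (n div 2)" using assms by (intro power_strict_decreasing) auto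
    then show ?thesis unfolding dist using False by (simp del: power_Suc)
  qed
  then show ?case using Suc by (cases "m = n") auto
qed simp

definition adversary :: "real \<Rightarrow> nat \<Rightarrow> nat \<Rightarrow> real list" where
  "adversary \<delta> k n = map (\<lambda>i. if i = 0 then \<delta> ^ k / 2 else zigzag \<delta> (i - 1)) [0..<n]"

lemma adversary_Suc:
  "adversary \<delta> k (Suc n) = adversary \<delta> k n @ [if n = 0 then \<delta> ^ k / 2 else zigzag \<delta> (n - 1)]"
  by (simp add: adversary_def)

lemma length_adversary [simp]: "length (adversary \<delta> k n) = n"
  by (simp add: adversary_def)

lemma sum_list_adversary:
  "sum_list (adversary \<delta> k (Suc n)) = \<delta> ^ k / 2 + sum_list (map (zigzag \<delta>) [0..<n])"
  by (induction n) (simp_all add: adversary_Suc, simp add: adversary_def)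

text \<open>All requests on the side of the new server move one server outwards.\<close>

lemma adversary_shift_matching:
  assumes "0 < \<delta>" "\<delta> \<le> 1"
  shows "\<exists>N. mset N = mset (map (zigzag \<delta>) [0..<Suc n]) \<and>
    matching_cost (adversary \<delta> k (Suc n)) N = \<bar>zigzag \<delta> n - \<delta> ^ k / 2\<bar>"
proof (induction n rule: induct_nat_012)
  case 0
  then show ?case
    by (intro exI[of _ "[zigzag \<delta> 0]"]) (simp add: adversary_def matching_cost_def abs_minus_commute)
next
  case 1
  then show ?case
    by (intro exI[of _ "[zigzag \<delta> 1, zigzag \<delta> 0]"])
      (simp add: adversary_def matching_cost_def abs_minus_commute numeral_2_eq_2)
next
  case (ge2 n)
  then obtain N where N: "mset N = mset (map (zigzag \<delta>) [0..<Suc n])"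
    "matching_cost (adversary \<delta> k (Suc n)) N = \<bar>zigzag \<delta> n - \<delta> ^ k / 2\<bar>" by blast
  \<comment> \<open>The request at \<open>zigzag \<delta> n\<close> moves to the next server on its
    own side, the one at \<open>zigzag \<delta> (Suc n)\<close> stays in place; hence the induction
    in steps of two.\<close>
  let ?N = "N @ [zigzag \<delta> (Suc (Suc n)), zigzag \<delta> (Suc n)]"
  have \<eta>: "0 \<le> \<delta> ^ k / 2" "\<delta> ^ k / 2 \<le> 1" using assms power_le_one[of \<delta> k] by auto
  have len: "length N = Suc n" using arg_cong[OF N(1), of size] by simp
  have "matching_cost [zigzag \<delta> n, zigzag \<delta> (Suc n)] [zigzag \<delta> (Suc (Suc n)), zigzag \<delta> (Suc n)] =
      \<bar>zigzag \<delta> n - zigzag \<delta> (Suc (Suc n))\<bar>"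
    by (simp add: matching_cost_def numeral_2_eq_2)
  also have "\<dots> = \<delta> ^ Suc (n div 2)" using assms by (simp add: zigzag_def)
  finally have "matching_cost (adversary \<delta> k (Suc (Suc (Suc n)))) ?N = \<bar>zigzag \<delta> (Suc (Suc n)) - \<delta> ^ k / 2\<bar>"
    using N(2) len matching_cost_append[of N "adversary \<delta> k (Suc n)" "[zigzag \<delta> (Suc (Suc n)), zigzag \<delta> (Suc n)]"
        "[zigzag \<delta> n, zigzag \<delta> (Suc n)]"]
    by (simp add: adversary_Suc[of _ _ "Suc n"] adversary_Suc[of _ _ "Suc (Suc n)"]
        zigzag_dist[OF assms(1) \<eta>])
  then show ?case using N(1) by (intro exI[of _ ?N]) (simp add: add_mset_commute)
qed

lemma prefill_exists:
  assumes "finite S"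
  shows "\<exists>pre. set pre \<subseteq> S \<and> (\<forall>s\<in>S. count_list pre s = c s - 1)"
proof -
  obtain pre where pre: "mset pre = (\<Sum>s\<in>S. replicate_mset (c s - 1) s)" using ex_mset by blast
  have "count_list pre s = (if s \<in> S then c s - 1 else 0)" for s
    using assms by (simp add: count_mset[symmetric] pre count_sum sum.delta' sum.delta if_distrib cong: if_cong)
  moreover from this have "set pre \<subseteq> S" by (metis count_list_0_iff subsetI count_notin)
  ultimately show ?thesis by auto
qed

text \<open>The optimum pays only the distance of the server used last, whereas \<open>P\<close>
  pays at least \<open>1 - \<delta> ^ k / 2\<close> for the first adversarial request and at least 2
  for each of the other \<open>2 * k - 1\<close>.\<close>

lemma permutation_cost_lower_bound:
  assumes \<delta>: "0 < \<delta>" "\<delta> < 1" and k: "1 \<le> k" and S: "S = zigzag \<delta> ` {..<2 * k}"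
    and inst: "ofal_instance S c" and P: "permutation_algorithm S c P"
  shows "\<exists>\<sigma>. length \<sigma> \<le> sum c S \<and> opt_cost S c \<sigma> \<le> geo \<delta> k + \<delta> ^ k / 2 \<and>
    4 * real k - 1 - \<delta> ^ k / 2 \<le> matching_cost \<sigma> (P \<sigma>)"
proof -
  let ?\<eta> = "\<delta> ^ k / 2" and ?y = "zigzag \<delta>"
  have finS: "finite S" and c1: "\<And>s. s \<in> S \<Longrightarrow> 1 \<le> c s" using inst by (auto simp: ofal_instance_def)
  have \<eta>: "0 < ?\<eta>" "?\<eta> < 1" using \<delta> power_le_one[of \<delta> k] by auto
  note dist = zigzag_dist[OF \<delta>(1) less_imp_le[OF \<eta>(1)] less_imp_le[OF \<eta>(2)]]
  obtain pre where pre: "set pre \<subseteq> S" "\<And>s. s \<in> S \<Longrightarrow> count_list pre s = c s - 1"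
    using prefill_exists[OF finS] by blast
  \<comment> \<open>Serving the prefix in place leaves one free place at each server, which reduces
    the argument to capacities 1.\<close>
  define \<sigma> where "\<sigma> n = pre @ adversary \<delta> k n" for n
  have inj: "inj_on ?y {..<2 * k}"
  proof (rule linorder_inj_onI)
    fix m n assume "m < n" "m \<in> {..<2 * k}" "n \<in> {..<2 * k}"
    then show "?y m \<noteq> ?y n" using zigzag_dist_less[OF \<delta>, of m n k] by auto
  qed auto
  have cardS: "card S = 2 * k" using card_image[OF inj] by (simp add: S)
  have "length pre + card S = sum c S"
  proof -
    have "length pre = (\<Sum>s\<in>S. c s - 1)"
      using length_eq_sum_count_list[OF finS pre(1)] pre(2) by simp
    then have "length pre + card S = (\<Sum>s\<in>S. (c s - 1) + 1)" by (simp only: sum.distrib card_eq_sum)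
    also have "\<dots> = sum c S" by (intro sum.cong refl le_add_diff_inverse2 c1)
    finally show ?thesis .
  qed
  then have len: "length (\<sigma> n) + (2 * k - n) = sum c S" if "n \<le> 2 * k" for n
    using that cardS by (simp add: \<sigma>_def)
  obtain M where M: "\<And>\<sigma>. length \<sigma> \<le> sum c S \<Longrightarrow> optimal_matching S c \<sigma> (M \<sigma>)"
    and step: "\<And>\<sigma> r. length \<sigma> < sum c S \<Longrightarrow>
      \<exists>s. mset (M (\<sigma> @ [r])) = add_mset s (mset (M \<sigma>)) \<and> P (\<sigma> @ [r]) = P \<sigma> @ [s]"
    using P unfolding permutation_algorithm_def by blast
  have Mf: "feasible_matching S c (\<sigma> n) (M (\<sigma> n))" if "n \<le> 2 * k" for n
    using M[of "\<sigma> n"] len[OF that] by (auto simp: optimal_matching_def is_arg_min_def)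
  have Mopt: "matching_cost (\<sigma> n) (M (\<sigma> n)) \<le> matching_cost (\<sigma> n) N"
    if "n \<le> 2 * k" "feasible_matching S c (\<sigma> n) N" for n N
    using M[of "\<sigma> n"] len[OF that(1)] that(2) by (auto simp: optimal_matching_def is_arg_min_def not_less)
  have pre_cost: "matching_cost pre pre = 0" by (simp add: matching_cost_def)
  have shift: "\<exists>N. feasible_matching S c (\<sigma> (Suc n)) N \<and> matching_cost (\<sigma> (Suc n)) N = \<bar>?y n - ?\<eta>\<bar>"
    if n: "n < 2 * k" for n
  proof -
    obtain N where N: "mset N = mset (map ?y [0..<Suc n])"
      "matching_cost (adversary \<delta> k (Suc n)) N = \<bar>?y n - ?\<eta>\<bar>"
      using adversary_shift_matching[OF \<delta>(1) less_imp_le[OF \<delta>(2)]] by blast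
    have lenN: "length N = Suc n" using arg_cong[OF N(1), of size] by simp
    have setN: "set N \<subseteq> S" using arg_cong[OF N(1), of set_mset] n by (auto simp: S simp del: upt_Suc)
    have "distinct (map ?y [0..<Suc n])"
      using n by (auto simp: distinct_map simp del: upt_Suc intro: inj_on_subset[OF inj])
    then have "distinct N" using N(1) mset_eq_imp_distinct_iff by blast
    then have "count_list N s \<le> 1" for s by (simp add: distinct_count_atmost_1 count_mset[symmetric])
    then have "count_list (pre @ N) s \<le> c s" if "s \<in> S" for s
      using pre(2)[OF that] c1[OF that] by (metis add.commute add_le_mono count_list_append le_add_diff_inverse2 order_refl)
    then have "feasible_matching S c (\<sigma> (Suc n)) (pre @ N)"
      using lenN setN pre(1) by (auto simp: feasible_matching_def \<sigma>_def)
    moreover have "matching_cost (\<sigma> (Suc n)) (pre @ N) = \<bar>?y n - ?\<eta>\<bar>"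
      using N(2) lenN by (simp add: \<sigma>_def matching_cost_append pre_cost)
    ultimately show ?thesis by blast
  qed
  have used: "mset (M (\<sigma> n)) = mset pre + mset (map ?y [0..<n]) \<and> P (\<sigma> n) = P pre @ map ?y [0..<n]"
    if "n \<le> 2 * k" for n
    using that
  proof (induction n)
    case 0
    have \<sigma>0: "\<sigma> 0 = pre" by (simp add: \<sigma>_def adversary_def)
    have "count_list pre s \<le> c s" if "s \<in> S" for s using pre(2)[OF that] by simp
    \<comment> \<open>The prefix can be served for free, and a matching of cost 0 serves each
      request in place.\<close>
    then have "matching_cost pre (M pre) \<le> 0"
      using Mopt[of 0 pre] pre pre_cost by (auto simp: feasible_matching_def \<sigma>0)
    then have "\<forall>i<length pre. \<bar>pre ! i - M pre ! i\<bar> = 0"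
      unfolding matching_cost_def using sum_nonneg_eq_0_iff[of "{..<length pre}" "\<lambda>i. \<bar>pre ! i - M pre ! i\<bar>"]
      by (force intro: antisym sum_nonneg)
    moreover have "length (M pre) = length pre" using Mf[of 0] by (auto simp: feasible_matching_def \<sigma>0)
    ultimately have "M pre = pre" by (intro nth_equalityI) auto
    then show ?case by (simp add: \<sigma>0)
  next
    case (Suc n)
    then have n: "n < 2 * k" by simp
    define r where "r = (if n = 0 then ?\<eta> else ?y (n - 1))"
    have \<sigma>Suc: "\<sigma> (Suc n) = \<sigma> n @ [r]" by (simp add: \<sigma>_def adversary_Suc r_def)
    have l: "length (\<sigma> n) < sum c S" using len[OF less_imp_le[OF n]] n by arith
    obtain s where s: "mset (M (\<sigma> (Suc n))) = add_mset s (mset (M (\<sigma> n)))" "P (\<sigma> (Suc n)) = P (\<sigma> n) @ [s]"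
      using step[OF l, of r] unfolding \<sigma>Suc by blast
    have IH: "mset (M (\<sigma> n)) = mset pre + mset (map ?y [0..<n])" "P (\<sigma> n) = P pre @ map ?y [0..<n]"
      using Suc by auto
    have ms: "mset (M (\<sigma> (Suc n))) = mset (pre @ map ?y [0..<n] @ [s])" by (simp add: s IH)
    have f: "feasible_matching S c (\<sigma> (Suc n)) (M (\<sigma> (Suc n)))" using Mf n by simp
    have "s \<in> set (M (\<sigma> (Suc n)))" using ms by (metis in_set_conv_decomp set_mset_mset append_assoc)
    then have "s \<in> S" using f by (auto simp: feasible_matching_def)
    then obtain m where m: "m < 2 * k" "s = ?y m" by (auto simp: S)
    \<comment> \<open>The servers \<open>?y i\<close> with \<open>i < n\<close> are full:
      \<open>c s - 1\<close> places went to the prefix and one to the adversary.\<close>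
    have "n \<le> m"
    proof (rule ccontr)
      assume "\<not> n \<le> m"
      then have "s \<in> set (map ?y [0..<n])" using m by auto
      then have "0 < count_list (map ?y [0..<n]) s" by (metis count_list_0_iff gr0I)
      moreover have "count_list (M (\<sigma> (Suc n))) s \<le> c s" using f \<open>s \<in> S\<close> by (auto simp: feasible_matching_def)
      moreover have "count_list (M (\<sigma> (Suc n))) s = count_list (pre @ map ?y [0..<n] @ [s]) s"
        using ms by (metis count_mset)
      ultimately show False using pre(2)[OF \<open>s \<in> S\<close>] c1[OF \<open>s \<in> S\<close>] by simp
    qed
    \<comment> \<open>In the difference of sums everything cancels except \<open>s\<close> and
      \<open>?\<eta>\<close>, so any matching onto these servers costs at least their distance. The
      shifted matching attains the distance of \<open>?y n\<close>, the closest server with a free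
      place, which forces \<open>s = ?y n\<close>.\<close>
    have "sum_list (M (\<sigma> (Suc n))) = sum_list (pre @ map ?y [0..<n] @ [s])"
      using ms by (metis sum_mset_sum_list)
    then have "sum_list (M (\<sigma> (Suc n))) - sum_list (\<sigma> (Suc n)) = s - ?\<eta>"
      by (simp add: \<sigma>_def sum_list_adversary)
    then have "\<bar>s - ?\<eta>\<bar> \<le> matching_cost (\<sigma> (Suc n)) (M (\<sigma> (Suc n)))"
      using matching_cost_ge_sum_diff[of "M (\<sigma> (Suc n))" "\<sigma> (Suc n)"] f by (simp add: feasible_matching_def)
    also have "\<dots> \<le> \<bar>?y n - ?\<eta>\<bar>" using shift[OF n] Mopt[of "Suc n"] n by force
    finally have "m = n" using zigzag_dist_less[OF \<delta> _ m(1), of n] m \<open>n \<le> m\<close> by force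
    then show ?case using ms s(2) IH m by simp
  qed
  show ?thesis
  proof (intro exI[of _ "\<sigma> (2 * k)"] conjI)
    show "length (\<sigma> (2 * k)) \<le> sum c S" using len[of "2 * k"] by simp
    obtain N where N: "feasible_matching S c (\<sigma> (2 * k)) N" "matching_cost (\<sigma> (2 * k)) N = \<bar>?y (2 * k - 1) - ?\<eta>\<bar>"
      using shift[of "2 * k - 1"] k by auto
    have "finite {ms. feasible_matching S c (\<sigma> (2 * k)) ms}"
      by (rule finite_subset[OF _ finite_lists_length_eq[OF finS, of "length (\<sigma> (2 * k))"]])
        (auto simp: feasible_matching_def)
    then have "opt_cost S c (\<sigma> (2 * k)) \<le> matching_cost (\<sigma> (2 * k)) N"
      unfolding opt_cost_def using N(1) by (intro Min_le) auto
    moreover have "odd (2 * k - 1)" "Suc ((2 * k - 1) div 2) = k" using k by presburger+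
    ultimately show "opt_cost S c (\<sigma> (2 * k)) \<le> geo \<delta> k + ?\<eta>"
      unfolding N(2) dist by (simp del: geo_Suc)
    have "length (P pre) = length pre"
      using online_algorithm_feasible[OF permutation_algorithm_online[OF inst P], of pre] len[of 0]
      by (simp add: feasible_matching_def \<sigma>_def)
    then have "matching_cost (\<sigma> (2 * k)) (P (\<sigma> (2 * k))) =
        matching_cost pre (P pre) + matching_cost (adversary \<delta> k (2 * k)) (map ?y [0..<2 * k])"
      using used[of "2 * k"] by (simp add: \<sigma>_def matching_cost_append)
    moreover have "0 \<le> matching_cost pre (P pre)" by (auto simp: matching_cost_def intro: sum_nonneg)
    moreover have "2 * real n + 1 - ?\<eta> \<le> matching_cost (adversary \<delta> k (Suc n)) (map ?y [0..<Suc n])" for n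
    proof (induction n)
      case 0
      show ?case using \<eta> by (simp add: matching_cost_def adversary_def zigzag_def geo_def)
    next
      case (Suc n)
      have "matching_cost (adversary \<delta> k (Suc (Suc n))) (map ?y [0..<Suc (Suc n)]) =
          matching_cost (adversary \<delta> k (Suc n)) (map ?y [0..<Suc n]) + \<bar>?y n - ?y (Suc n)\<bar>"
        using matching_cost_append[of "map ?y [0..<Suc n]" "adversary \<delta> k (Suc n)" "[?y (Suc n)]" "[?y n]"]
        by (simp add: adversary_Suc[of _ _ "Suc n"] matching_cost_def[of "[_]"])
      \<comment> \<open>Consecutive servers of the zigzag lie on opposite sides of the origin, each
        at distance at least 1 from it.\<close>
      moreover have "2 \<le> \<bar>?y n - ?y (Suc n)\<bar>"
        using geo_ge_1[OF \<delta>(1), of "Suc (n div 2)"] geo_ge_1[OF \<delta>(1), of "Suc (Suc n div 2)"]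
        by (auto simp: zigzag_def simp del: geo_Suc)
      ultimately show ?case using Suc.IH by simp
    qed
    from this[of "2 * k - 1"] have "4 * real k - 1 - ?\<eta> \<le> matching_cost (adversary \<delta> k (2 * k)) (map ?y [0..<2 * k])"
      using k by (simp add: of_nat_diff)
    ultimately show "4 * real k - 1 - ?\<eta> \<le> matching_cost (\<sigma> (2 * k)) (P (\<sigma> (2 * k)))" by linarith
  qed
qed

section \<open>Both bounds for the given \<open>k\<close>, \<open>\<epsilon>\<close> and
  \<open>\<delta>\<close>\<close>

theorem theorem4:
  fixes k :: nat and \<epsilon> \<delta> :: real and s :: "nat \<Rightarrow> real" and S :: "real set"
    and c :: "real \<Rightarrow> nat"
  assumes "k \<ge> 1" and "\<epsilon> > 0"
    and "\<delta> > 0" and "\<delta> \<noteq> 1"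
    and "\<delta> ^ k + \<delta> * (4 * real k - 1) < \<epsilon>"
    and "inverse (1 - \<delta>) < 1 + \<epsilon> / 2"
    and "\<And>i. i \<in> {1..k} \<Longrightarrow> s (k + i) = (1 - \<delta> ^ i) / (1 - \<delta>)"
    and "\<And>i. i \<in> {1..k} \<Longrightarrow> s (k - i + 1) = - ((1 - \<delta> ^ i) / (1 - \<delta>))"
    and "S = s ` {1..2 * k}"
    and "ofal_instance S c"
  shows "(\<forall>p. gap_choice p \<longrightarrow> competitive S c (ptcp_algorithm p S c) (3 + \<epsilon>)) \<and>
         (\<forall>P. permutation_algorithm S c P \<longrightarrow>
            ereal (4 * real k - 1 - \<epsilon>) \<le> competitive_ratio S c P)"
proof -
  note s_right = assms(7)[folded geo_closed[OF assms(4)]]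
  note s_left = assms(8)[folded geo_closed[OF assms(4)]]
  have S: "S = zigzag \<delta> ` {..<2 * k}"
  proof (intro set_eqI iffI)
    fix t assume "t \<in> S"
    then obtain m where m: "m \<in> {1..2 * k}" "t = s m" using assms(9) by auto
    show "t \<in> zigzag \<delta> ` {..<2 * k}"
    proof (cases "k < m")
      case True
      then have "m - k \<in> {1..k}" "k + (m - k) = m" using m by auto
      then show ?thesis using s_right[of "m - k"] m by (auto simp: in_zigzag_iff)
    next
      case False
      then have eq: "k - (k - m + 1) + 1 = m" and mem: "k - m + 1 \<in> {1..k}" using m by auto
      have "t = - geo \<delta> (k - m + 1)" using s_left[OF mem] unfolding eq m(2) .
      then show ?thesis unfolding in_zigzag_iff using mem by blast
    qed
  next
    fix t assume "t \<in> zigzag \<delta> ` {..<2 * k}"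
    then obtain i where i: "i \<in> {1..k}" "t = geo \<delta> i \<or> t = - geo \<delta> i" using in_zigzag_iff by blast
    then have "t = s (k + i) \<or> t = s (k - i + 1)" using s_right s_left by auto
    moreover have "k + i \<in> {1..2 * k}" "k - i + 1 \<in> {1..2 * k}" using i(1) by auto
    ultimately show "t \<in> S" unfolding assms(9) by blast
  qed
  \<comment> \<open>Both summands of the assumed lower bound on \<open>\<epsilon>\<close> are at
    least their values at \<open>\<delta> = 1\<close>.\<close>
  have large: "4 * real k < \<epsilon>" if "1 < \<delta>"
  proof -
    have "4 * real k = 1 + 1 * (4 * real k - 1)" by simp
    also have "\<dots> \<le> \<delta> ^ k + \<delta> * (4 * real k - 1)"
      using that assms(1) by (intro add_mono mult_right_mono one_le_power) auto
    also have "\<dots> < \<epsilon>" by (rule assms(5))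
    finally show ?thesis .
  qed
  have upper: "competitive S c (ptcp_algorithm p S c) (3 + \<epsilon>)" if "gap_choice p" for p
  proof (cases "\<delta> < 1")
    case True
    show ?thesis
    proof (rule ptcp_competitive[OF assms(10) that])
      show "1 \<le> 1 / (1 - \<delta>)" using True assms(3) by simp
      show "has_wide_gaps (1 / (1 - \<delta>)) S" unfolding S using True assms(3) by (intro zigzag_wide_gaps)
      show "1 + 2 * (1 / (1 - \<delta>)) \<le> 3 + \<epsilon>" using assms(6) by (simp add: inverse_eq_divide)
    qed
  next
    case False
    \<comment> \<open>Here \<open>\<delta> > 1\<close>. The bound for arbitrary sets of at most
      \<open>2 * k\<close> servers gives the factor \<open>1 + 2 * (2 * k - 1) = 4 * k - 1\<close>,
      which is below \<open>\<epsilon>\<close>.\<close>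
    have "card S \<le> 2 * k" unfolding S using card_image_le[of "{..<2 * k}" "zigzag \<delta>"] by simp
    show ?thesis
    proof (rule ptcp_competitive[OF assms(10) that])
      show "1 \<le> 2 * real k - 1" using assms(1) by simp
      show "has_wide_gaps (2 * real k - 1) S"
        using \<open>card S \<le> 2 * k\<close> by (intro has_wide_gaps_mono[OF has_wide_gaps_card]) (auto simp: S)
      show "1 + 2 * (2 * real k - 1) \<le> 3 + \<epsilon>" using large False assms(4) by simp
    qed
  qed
  have lower: "4 * real k - 1 - \<epsilon> \<le> \<beta>"
    if P: "permutation_algorithm S c P" and \<beta>: "1 \<le> \<beta>" "competitive S c P \<beta>" for P \<beta>
  proof (cases "\<delta> < 1")
    case True
    let ?\<eta> = "\<delta> ^ k / 2"
    obtain \<sigma> where \<sigma>: "length \<sigma> \<le> sum c S" "opt_cost S c \<sigma> \<le> geo \<delta> k + ?\<eta>"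
      "4 * real k - 1 - ?\<eta> \<le> matching_cost \<sigma> (P \<sigma>)"
      using permutation_cost_lower_bound[OF assms(3) True assms(1) S assms(10) P] by blast
    have pos: "0 < \<delta> ^ k" "0 < 1 - \<delta>" using assms(3) True by auto
    \<comment> \<open>The optimum is at most the limit of the geometric series; its reciprocal is
      the factor \<open>1 - \<delta>\<close> lost in the ratio.\<close>
    have "geo \<delta> k + ?\<eta> \<le> 1 / (1 - \<delta>)"
    proof -
      have "(1 - \<delta>) * geo \<delta> k = 1 - \<delta> ^ k" using True by (simp add: geo_closed)
      then have "(1 - \<delta>) * (geo \<delta> k + ?\<eta>) = 1 - \<delta> ^ k + (1 - \<delta>) * ?\<eta>"
        by (simp only: distrib_left)
      also have "\<dots> \<le> 1 - \<delta> ^ k + 1 * ?\<eta>" using pos assms(3) by (intro add_left_mono mult_right_mono) auto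
      also have "\<dots> \<le> 1" using pos by simp
      finally show ?thesis using pos by (simp add: field_simps)
    qed
    have "4 * real k - 1 - ?\<eta> \<le> \<beta> * opt_cost S c \<sigma>"
      using \<beta>(2) \<sigma> unfolding competitive_def by force
    also have "\<dots> \<le> \<beta> * (1 / (1 - \<delta>))"
      using \<beta>(1) \<sigma>(2) \<open>geo \<delta> k + ?\<eta> \<le> 1 / (1 - \<delta>)\<close> by (intro mult_left_mono) auto
    finally have "(4 * real k - 1 - ?\<eta>) * (1 - \<delta>) \<le> \<beta>" using pos by (simp add: field_simps)
    \<comment> \<open>The loss against \<open>4 * k - 1\<close> is at most
      \<open>\<delta> ^ k + \<delta> * (4 * k - 1)\<close>, the quantity assumed to be smaller than
      \<open>\<epsilon>\<close>.\<close>
    moreover have "(4 * real k - 1 - ?\<eta>) * (1 - \<delta>) =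
        4 * real k - 1 - (\<delta> ^ k + \<delta> * (4 * real k - 1)) + (?\<eta> + ?\<eta> * \<delta>)"
      by (simp add: field_simps)
    moreover have "0 \<le> ?\<eta> + ?\<eta> * \<delta>" using pos assms(3) by simp
    ultimately show ?thesis using assms(5) by linarith
  next
    case False
    \<comment> \<open>The claimed bound is negative in this case.\<close>
    then show ?thesis using large assms(4) \<beta>(1) by simp
  qed
  show ?thesis
    using upper lower unfolding competitive_ratio_def by (auto intro!: Inf_greatest)
qed

end
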